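(* Let $\nu$ be an infinite regular cardinal with $\kappa=\nu^+=2^\nu$. Let $\mathscr{Coh}(\kappa,\nu)$ be the set of all $\nu$-coherent $C$-sequences of length $\kappa$, with the topology whose basic open sets are the sets of all elements of $\mathscr{Coh}(\kappa,\nu)$ extending a given $\nu$-coherent $C$-sequence of length less than $\kappa$, and let $\mathscr{Triv}(\kappa,\nu)\subseteq\mathscr{Coh}(\kappa,\nu)$ be the set of all trivial $\nu$-coherent $C$-sequences of length $\kappa$. Then: (i) $\mathscr{Triv}(\kappa,\nu)$ is the image of ${}^\kappa\kappa$ under a continuous injective function ${}^\kappa\kappa\to\mathscr{Coh}(\kappa,\nu)$; (ii) $\mathscr{Triv}(\kappa,\nu)$ does not have the $\kappa$-Baire property in $\mathscr{Coh}(\kappa,\nu)$.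
   Context: For an ordinal $\gamma$, a sequence $\langle C_\alpha:\alpha<\gamma\rangle$ is a $C$-sequence if for all $\alpha<\gamma$: if $\alpha$ is a limit ordinal then $C_\alpha$ is a closed unbounded subset of $\alpha$, and if $\alpha=\bar\alpha+1$ then $C_\alpha=\{\bar\alpha\}$. A $C$-sequence $\langle C_\alpha:\alpha<\gamma\rangle$ is $\nu$-coherent if $C_\alpha=C_\beta\cap\alpha$ for all $\beta<\gamma$ and all limit points $\alpha$ of $C_\beta$ with $\mathrm{cof}(\alpha)=\nu$. A $C$-sequence $\langle C_\alpha:\alpha<\gamma\rangle$ with $\gamma$ a limit ordinal is trivial if there is a closed unbounded $C\subseteq\gamma$ such that for every $\alpha<\gamma$ there is $\beta$ with $\alpha\le\beta<\gamma$ and $C\cap\alpha\subseteq C_\beta$. ${}^\kappa\kappa$ carries the topology with basic open sets $N_s=\{x : s\subseteq x\}$, $s$ a function from an ordinal below $\kappa$ to $\kappa$. A subset $A$ of a topological space $X$ has the $\kappa$-Baire property if there are an open $U\subseteq X$ and nowhere dense sets $N_\alpha\subseteq X$ ($\alpha<\kappa$) with the symmetric difference of $A$ and $U$ contained in $\bigcup_{\alpha<\kappa}N_\alpha$. *)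

theory Defs
  imports "HOL-Analysis.Analysis"
begin

text \<open>Ordinals below kappa are modelled as the elements of the field of a well-order r
(whose order type is kappa).  underS r a is the set of ordinals strictly below a.\<close>

definition ord_lt :: "'a rel \<Rightarrow> 'a \<Rightarrow> 'a \<Rightarrow> bool" where
  "ord_lt r a b \<longleftrightarrow> (a, b) \<in> r \<and> a \<noteq> b"

definition is_succ_of :: "'a rel \<Rightarrow> 'a \<Rightarrow> 'a \<Rightarrow> bool" where
  "is_succ_of r a b \<longleftrightarrow> ord_lt r b a \<and> \<not> (\<exists>c. ord_lt r b c \<and> ord_lt r c a)"

text \<open>limit ordinal: not a successor (0 included; a club in 0 is necessarily empty)\<close>
definition is_limit :: "'a rel \<Rightarrow> 'a \<Rightarrow> bool" where
  "is_limit r a \<longleftrightarrow> a \<in> Field r \<and> \<not> (\<exists>b. is_succ_of r a b)"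

definition unbounded_in :: "'a rel \<Rightarrow> 'a set \<Rightarrow> 'a set \<Rightarrow> bool" where
  "unbounded_in r D C \<longleftrightarrow> (\<forall>d\<in>D. \<exists>c\<in>C. (d, c) \<in> r)"

definition is_limit_point :: "'a rel \<Rightarrow> 'a set \<Rightarrow> 'a \<Rightarrow> bool" where
  "is_limit_point r C b \<longleftrightarrow> underS r b \<noteq> {} \<and> is_limit r b
      \<and> unbounded_in r (underS r b) (C \<inter> underS r b)"

definition closed_in_ord :: "'a rel \<Rightarrow> 'a set \<Rightarrow> 'a set \<Rightarrow> bool" where
  "closed_in_ord r D C \<longleftrightarrow> (\<forall>b\<in>D. is_limit_point r C b \<longrightarrow> b \<in> C)"

text \<open>C is a closed unbounded subset of D (D an initial segment of the ordinals)\<close>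
definition club_in :: "'a rel \<Rightarrow> 'a set \<Rightarrow> 'a set \<Rightarrow> bool" where
  "club_in r D C \<longleftrightarrow> C \<subseteq> D \<and> unbounded_in r D C \<and> closed_in_ord r D C"

definition cof_eq :: "'a rel \<Rightarrow> 'b rel \<Rightarrow> 'a \<Rightarrow> bool" where
  "cof_eq r n a \<longleftrightarrow>
     (\<exists>A. A \<subseteq> underS r a \<and> unbounded_in r (underS r a) A \<and> (card_of A, n) \<in> ordIso) \<and>
     (\<forall>A. A \<subseteq> underS r a \<and> unbounded_in r (underS r a) A \<longrightarrow> (n, card_of A) \<in> ordLeq)"

text \<open>C-sequence with domain D (an initial segment); values outside D are empty\<close>
definition Cseq :: "'a rel \<Rightarrow> 'a set \<Rightarrow> ('a \<Rightarrow> 'a set) \<Rightarrow> bool" where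
  "Cseq r D c \<longleftrightarrow>
     (\<forall>a\<in>D. (is_limit r a \<longrightarrow> club_in r (underS r a) (c a))
            \<and> (\<forall>b. is_succ_of r a b \<longrightarrow> c a = {b}))
     \<and> (\<forall>a. a \<notin> D \<longrightarrow> c a = {})"

definition nu_coherent :: "'a rel \<Rightarrow> 'b rel \<Rightarrow> 'a set \<Rightarrow> ('a \<Rightarrow> 'a set) \<Rightarrow> bool" where
  "nu_coherent r n D c \<longleftrightarrow> Cseq r D c \<and>
     (\<forall>b\<in>D. \<forall>a. a \<in> underS r b \<and> is_limit_point r (c b) a \<and> cof_eq r n a
                 \<longrightarrow> c a = c b \<inter> underS r a)"

definition Coh :: "'a rel \<Rightarrow> 'b rel \<Rightarrow> ('a \<Rightarrow> 'a set) set" where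
  "Coh r n = {c. nu_coherent r n (Field r) c}"

definition Coh_top :: "'a rel \<Rightarrow> 'b rel \<Rightarrow> ('a \<Rightarrow> 'a set) topology" where
  "Coh_top r n = topology_generated_by
     {{C \<in> Coh r n. \<forall>a\<in>underS r g. C a = c a} | g c.
        g \<in> Field r \<and> nu_coherent r n (underS r g) c}"

definition Triv :: "'a rel \<Rightarrow> 'b rel \<Rightarrow> ('a \<Rightarrow> 'a set) set" where
  "Triv r n = {c \<in> Coh r n. \<exists>C. club_in r (Field r) C \<and>
       (\<forall>a\<in>Field r. \<exists>b\<in>Field r. (a, b) \<in> r \<and> C \<inter> underS r a \<subseteq> c b)}"

definition Baire_space :: "'a rel \<Rightarrow> ('a \<Rightarrow> 'a) topology" where
  "Baire_space r = topology_generated_by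
     {{x \<in> Field r \<rightarrow>\<^sub>E Field r. \<forall>a\<in>underS r g. x a = s a} | g s.
        g \<in> Field r \<and> s \<in> underS r g \<rightarrow> Field r}"

definition nowhere_dense :: "'x topology \<Rightarrow> 'x set \<Rightarrow> bool" where
  "nowhere_dense X N \<longleftrightarrow> N \<subseteq> topspace X \<and> X interior_of (X closure_of N) = {}"

definition kappa_Baire :: "'x topology \<Rightarrow> 'a rel \<Rightarrow> 'x set \<Rightarrow> bool" where
  "kappa_Baire X r A \<longleftrightarrow> (\<exists>U N. openin X U \<and> (\<forall>a\<in>Field r. nowhere_dense X (N a))
       \<and> (A - U) \<union> (U - A) \<subseteq> (\<Union>a\<in>Field r. N a))"

end

theory Submission
  imports Defs
begin

text \<open>Call a club \<open>D \<subseteq> \<kappa>\<close> a thread of \<open>c\<close> if \<open>c(\<delta>) = D \<inter> \<delta>\<close> for all limit points \<open>\<delta>\<close> of \<open>D\<close> of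
  cofinality \<open>\<nu>\<close>. Since two clubs have unboundedly many common limit points of cofinality \<open>\<nu>\<close>,
  a \<open>\<nu>\<close>-coherent sequence has at most one thread, and it is trivial iff it has one.

  For (i), a pair \<open>(c, D)\<close> is built by enumerating \<open>D\<close>. Given \<open>D \<inter> \<gamma>\<close> and \<open>c\<close> below \<open>\<gamma> \<in> D\<close>, one
  chooses the next element \<open>\<gamma>'\<close> of \<open>D\<close> together with \<open>c\<close> on \<open>[\<gamma>, \<gamma>')\<close>. There are exactly \<open>\<kappa>\<close> choices,
  even when \<open>c(\<gamma>)\<close> is forced: at least \<open>\<kappa>\<close> because \<open>\<gamma>'\<close> is free, at most \<open>\<kappa>\<close> because
  \<open>2\<^sup>\<nu> = \<kappa>\<close>. Coding the choices by elements of \<open>\<kappa>\<close> gives a continuous bijection; it is injective because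
  the sequence determines its thread.

  For (ii), if the open set approximating the trivial sequences is empty, the same construction can
  dodge \<open>\<kappa>\<close> many nowhere dense sets and yields a trivial sequence outside of them. If it is nonempty,
  a construction inside it dodges the nowhere dense sets and puts, at all limit stages, a
  club without limit points of cofinality \<open>\<nu>\<close>; no thread can agree with these.\<close>

unbundle cardinal_syntax

section \<open>Order, limit points and suprema in a well-order\<close>

locale well_ordered =
  fixes r :: "'a rel"
  assumes well: "Well_order r"
begin

abbreviation le :: "'a \<Rightarrow> 'a \<Rightarrow> bool" (infix "\<sqsubseteq>" 50) where "a \<sqsubseteq> b \<equiv> (a, b) \<in> r"
abbreviation lt :: "'a \<Rightarrow> 'a \<Rightarrow> bool" (infix "\<sqsubset>" 50) where "a \<sqsubset> b \<equiv> a \<in> underS r b"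

lemma wo: "wo_rel r"
  using well by (simp add: wo_rel_def)

lemma lt_iff: "a \<sqsubset> b \<longleftrightarrow> a \<noteq> b \<and> a \<sqsubseteq> b"
  by (auto simp: underS_def)

lemma ord_lt_iff: "ord_lt r a b \<longleftrightarrow> a \<sqsubset> b"
  by (auto simp: ord_lt_def lt_iff)

lemma le_Field: "a \<sqsubseteq> b \<Longrightarrow> a \<in> Field r" "a \<sqsubseteq> b \<Longrightarrow> b \<in> Field r"
  by (auto simp: Field_def)

lemma lt_Field: "a \<sqsubset> b \<Longrightarrow> a \<in> Field r" "a \<sqsubset> b \<Longrightarrow> b \<in> Field r"
  by (auto simp: lt_iff Field_def)

lemma lt_irrefl [simp]: "\<not> a \<sqsubset> a"
  by (simp add: lt_iff)

lemma lt_le: "a \<sqsubset> b \<Longrightarrow> a \<sqsubseteq> b"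
  by (simp add: lt_iff)

lemma le_refl: "a \<in> Field r \<Longrightarrow> a \<sqsubseteq> a"
  using wo_rel.REFL[OF wo] by (auto simp: refl_on_def)

lemma le_trans: "a \<sqsubseteq> b \<Longrightarrow> b \<sqsubseteq> c \<Longrightarrow> a \<sqsubseteq> c"
  using wo_rel.TRANS[OF wo] by (meson transD)

lemma le_antisym: "a \<sqsubseteq> b \<Longrightarrow> b \<sqsubseteq> a \<Longrightarrow> a = b"
  using wo_rel.ANTISYM[OF wo] by (meson antisymD)

lemma lt_le_trans: "a \<sqsubset> b \<Longrightarrow> b \<sqsubseteq> c \<Longrightarrow> a \<sqsubset> c"
  by (metis le_antisym le_trans lt_iff)

lemma le_lt_trans: "a \<sqsubseteq> b \<Longrightarrow> b \<sqsubset> c \<Longrightarrow> a \<sqsubset> c"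
  by (metis le_antisym le_trans lt_iff)

lemma lt_trans: "a \<sqsubset> b \<Longrightarrow> b \<sqsubset> c \<Longrightarrow> a \<sqsubset> c"
  by (metis le_lt_trans lt_le)

lemma lt_asym: "a \<sqsubset> b \<Longrightarrow> \<not> b \<sqsubseteq> a"
  using lt_le_trans lt_irrefl by blast

lemma not_lt: "a \<in> Field r \<Longrightarrow> b \<in> Field r \<Longrightarrow> \<not> a \<sqsubset> b \<longleftrightarrow> b \<sqsubseteq> a"
  by (metis lt_asym le_refl lt_iff wo_rel.TOTALS[OF wo])

lemma not_le: "a \<in> Field r \<Longrightarrow> b \<in> Field r \<Longrightarrow> \<not> a \<sqsubseteq> b \<longleftrightarrow> b \<sqsubset> a"
  using not_lt by blast

lemma lt_cases:
  assumes "a \<in> Field r" "b \<in> Field r"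
  obtains "a \<sqsubset> b" | "a = b" | "b \<sqsubset> a"
  by (metis assms lt_iff not_lt)

lemma le_cases:
  assumes "a \<in> Field r" "b \<in> Field r"
  obtains "a \<sqsubseteq> b" | "b \<sqsubseteq> a"
  by (metis assms wo_rel.TOTALS[OF wo])

lemma least_exists:
  assumes "a \<in> Field r" "P a"
  shows "\<exists>m\<in>Field r. P m \<and> (\<forall>s\<in>Field r. P s \<longrightarrow> m \<sqsubseteq> s)"
proof -
  let ?S = "{a \<in> Field r. P a}"
  have "?S \<subseteq> Field r" "?S \<noteq> {}" using assms by auto
  from wo_rel.minim_in[OF wo this] wo_rel.minim_least[OF wo this(1)] show ?thesis by blast
qed

lemma lt_induct [consumes 1, case_names less]:
  assumes "a \<in> Field r" "\<And>a. a \<in> Field r \<Longrightarrow> (\<And>b. b \<sqsubset> a \<Longrightarrow> P b) \<Longrightarrow> P a"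
  shows "P a"
proof -
  have "a \<in> Field r \<longrightarrow> P a"
    by (rule wo_rel.well_order_induct[OF wo]) (metis assms(2) lt_Field(1) lt_iff)
  then show ?thesis using assms(1) by blast
qed

lemma underS_mono: "a \<sqsubseteq> b \<Longrightarrow> underS r a \<subseteq> underS r b"
  using lt_le_trans by blast

lemma is_succ_iff: "is_succ_of r a b \<longleftrightarrow> b \<sqsubset> a \<and> (\<forall>c. c \<sqsubset> a \<longrightarrow> c \<sqsubseteq> b)"
  unfolding is_succ_of_def ord_lt_iff
  by (metis lt_Field lt_asym not_lt)

lemma is_succ_unique: "is_succ_of r a b \<Longrightarrow> is_succ_of r a c \<Longrightarrow> b = c"
  by (meson is_succ_iff le_antisym)

lemma is_limit_iff: "is_limit r a \<longleftrightarrow> a \<in> Field r \<and> (\<forall>d. d \<sqsubset> a \<longrightarrow> (\<exists>e. d \<sqsubset> e \<and> e \<sqsubset> a))"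
  unfolding is_limit_def is_succ_of_def ord_lt_iff by blast

lemma limit_point_iff:
  "is_limit_point r C b \<longleftrightarrow> underS r b \<noteq> {} \<and> (\<forall>d. d \<sqsubset> b \<longrightarrow> (\<exists>c\<in>C. d \<sqsubset> c \<and> c \<sqsubset> b))"
proof
  assume L: "is_limit_point r C b"
  have "\<exists>c\<in>C. d \<sqsubset> c \<and> c \<sqsubset> b" if d: "d \<sqsubset> b" for d
  proof -
    obtain e where "d \<sqsubset> e" "e \<sqsubset> b" using L d by (auto simp: is_limit_point_def is_limit_iff)
    moreover obtain c where "c \<in> C" "c \<sqsubset> b" "e \<sqsubseteq> c"
      using L \<open>e \<sqsubset> b\<close> unfolding is_limit_point_def unbounded_in_def by blast
    ultimately show ?thesis using lt_le_trans by blast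
  qed
  then show "underS r b \<noteq> {} \<and> (\<forall>d. d \<sqsubset> b \<longrightarrow> (\<exists>c\<in>C. d \<sqsubset> c \<and> c \<sqsubset> b))"
    using L by (auto simp: is_limit_point_def)
next
  assume R: "underS r b \<noteq> {} \<and> (\<forall>d. d \<sqsubset> b \<longrightarrow> (\<exists>c\<in>C. d \<sqsubset> c \<and> c \<sqsubset> b))"
  then show "is_limit_point r C b"
    unfolding is_limit_point_def is_limit_iff unbounded_in_def
    by (metis (no_types, lifting) Int_iff equals0I lt_Field(2) lt_le)
qed

lemma limit_point_cong:
  "C \<inter> underS r b = C' \<inter> underS r b \<Longrightarrow> is_limit_point r C b = is_limit_point r C' b"
  by (simp add: is_limit_point_def)

lemma limit_point_mono:
  "is_limit_point r C b \<Longrightarrow> C \<inter> underS r b \<subseteq> C' \<Longrightarrow> is_limit_point r C' b"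
  unfolding limit_point_iff by blast

lemma limit_point_Field: "is_limit_point r C b \<Longrightarrow> b \<in> Field r"
  by (simp add: is_limit_point_def is_limit_def)

lemma limit_point_is_limit: "is_limit_point r C b \<Longrightarrow> is_limit r b"
  by (simp add: is_limit_point_def)

text \<open>A limit point \<open>l\<close> of \<open>B\<close> above \<open>d\<close> can be
  replaced by an element of \<open>B\<close> between \<open>d\<close> and \<open>l\<close>. So
  closing off a set creates no further limit points; \<open>thin_club\<close> needs this for closure
  and for cofinalities.\<close>

lemma limit_point_limit_points:
  assumes "is_limit_point r (B \<union> {a. a \<sqsubset> c \<and> is_limit_point r B a}) b"
  shows "is_limit_point r B b"
  unfolding limit_point_iff
proof (intro conjI allI impI)
  show "underS r b \<noteq> {}" using assms by (simp add: limit_point_iff)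
  fix d assume "d \<sqsubset> b"
  then obtain l where l: "l \<in> B \<or> is_limit_point r B l" "d \<sqsubset> l" "l \<sqsubset> b"
    using assms unfolding limit_point_iff by blast
  then show "\<exists>c\<in>B. d \<sqsubset> c \<and> c \<sqsubset> b"
    by (metis limit_point_iff lt_trans)
qed

text \<open>\<open>lub {}\<close> is the least element.\<close>

definition lub :: "'a set \<Rightarrow> 'a" where
  "lub A = wo_rel.minim r {b \<in> Field r. \<forall>a\<in>A. a \<sqsubseteq> b}"

lemma lub_props:
  assumes "u \<in> Field r" "\<forall>a\<in>A. a \<sqsubseteq> u"
  shows lub_Field: "lub A \<in> Field r"
    and lub_upper: "\<And>a. a \<in> A \<Longrightarrow> a \<sqsubseteq> lub A"
    and lub_least: "\<And>b. b \<in> Field r \<Longrightarrow> \<forall>a\<in>A. a \<sqsubseteq> b \<Longrightarrow> lub A \<sqsubseteq> b"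
proof -
  let ?B = "{b \<in> Field r. \<forall>a\<in>A. a \<sqsubseteq> b}"
  have sub: "?B \<subseteq> Field r" by blast
  have ne: "?B \<noteq> {}" using assms by blast
  have *: "lub A \<in> ?B" unfolding lub_def by (rule wo_rel.minim_in[OF wo sub ne])
  then show "lub A \<in> Field r" "\<And>a. a \<in> A \<Longrightarrow> a \<sqsubseteq> lub A" by auto
  fix b assume "b \<in> Field r" "\<forall>a\<in>A. a \<sqsubseteq> b"
  then show "lub A \<sqsubseteq> b" unfolding lub_def by (intro wo_rel.minim_least[OF wo sub]) auto
qed

text \<open>A point below \<open>lub A\<close> outside all these segments would be an upper bound of
  \<open>A\<close> smaller than the least one. For empty \<open>A\<close> both sides are empty, so
  stage 0 of a run is no special case.\<close>

lemma underS_lub: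
  assumes "u \<in> Field r" "\<forall>a\<in>A. a \<sqsubseteq> u"
  shows "underS r (lub A) = (\<Union>a\<in>A. underS r a)"
proof
  show "(\<Union>a\<in>A. underS r a) \<subseteq> underS r (lub A)"
    using lub_upper[OF assms] underS_mono by blast
  show "underS r (lub A) \<subseteq> (\<Union>a\<in>A. underS r a)"
  proof
    fix x assume x: "x \<sqsubset> lub A"
    show "x \<in> (\<Union>a\<in>A. underS r a)"
    proof (rule ccontr)
      assume "x \<notin> (\<Union>a\<in>A. underS r a)"
      then have "a \<sqsubseteq> x" if "a \<in> A" for a
        using that not_lt[of x a] lt_Field(1)[OF x] assms(2) le_Field by blast
      then have "lub A \<sqsubseteq> x" using lub_least[OF assms, of x] lt_Field(1)[OF x] by blast
      then show False using x lt_asym by blast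
    qed
  qed
qed

end

section \<open>The cardinals \<nu> and \<kappa>, and regularity of \<kappa>\<close>

locale nu_kappa =
  fixes n :: "'b rel" and r :: "'a rel"
  assumes card_n: "Card_order n" and inf_n: "\<not> finite (Field n)" and reg_n: "regularCard n"
    and well_r: "Well_order r" and r_succ: "(r, cardSuc n) \<in> ordIso"
    and r_pow: "(card_of (Pow (Field n)), r) \<in> ordIso"

sublocale nu_kappa \<subseteq> well_ordered r
  by unfold_locales (rule well_r)

sublocale nu_kappa \<subseteq> N: well_ordered n
  using card_n by unfold_locales (simp add: card_order_on_def)

context nu_kappa
begin

lemma card_r: "Card_order r"
  using r_succ card_n Card_order_ordIso cardSuc_Card_order by blast

lemma n_less_r: "n <o r"
  using cardSuc_greater[OF card_n] r_succ ordIso_symmetric ordLess_ordIso_trans by blast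

lemma le_n_iff: "|A| \<le>o n \<longleftrightarrow> |A| <o r"
  using cardSuc_ordLeq_ordLess[OF card_n card_of_Card_order] r_succ
  by (metis ordIso_symmetric ordLess_ordIso_trans)

lemma inf_r: "\<not> finite (Field r)"
  by (meson card_of_mono2 card_of_ordLeq_infinite inf_n n_less_r ordLess_imp_ordLeq)

lemma reg_r: "regularCard r"
  using regularCard_ordIso[OF ordIso_symmetric[OF r_succ]] infinite_cardSuc_regularCard[OF inf_n card_n]
    card_n inf_n Cinfinite_cardSuc by (metis cinfinite_def)

lemma card_underS: "a \<in> Field r \<Longrightarrow> |underS r a| \<le>o n"
  by (simp add: le_n_iff card_of_underS[OF card_r])

text \<open>By regularity of \<kappa> a cofinal set has size \<kappa>, hence more than \<nu>
  elements. Negating \<open>cofinal\<close> only gives a weak bound \<open>b\<close>, whence the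
  passage to a larger \<open>b'\<close>.\<close>

lemma bounded:
  assumes "A \<subseteq> Field r" "|A| \<le>o n"
  obtains b where "b \<in> Field r" "\<And>a. a \<in> A \<Longrightarrow> a \<sqsubset> b"
proof -
  have less: "|A| <o r" using assms(2) le_n_iff by blast
  have "\<not> cofinal A r"
  proof
    assume "cofinal A r"
    then have "|A| =o r" using reg_r assms(1) by (simp add: regularCard_def)
    then show False using less not_ordLess_ordIso by blast
  qed
  then obtain b where b: "b \<in> Field r" "\<And>a. a \<in> A \<Longrightarrow> \<not> b \<sqsubset> a"
    by (auto simp: cofinal_def lt_iff)
  obtain b' where "b \<sqsubset> b'"
    using infinite_Card_order_limit[OF card_r inf_r b(1)] by (auto simp: lt_iff)
  then have "a \<sqsubset> b'" if "a \<in> A" for a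
    using b that assms(1) not_lt[of b a] le_lt_trans by blast
  then show ?thesis using that lt_Field(2)[OF \<open>b \<sqsubset> b'\<close>] by blast
qed

lemma greater_exists:
  assumes "a \<in> Field r"
  obtains b where "a \<sqsubset> b" "b \<in> Field r"
  using infinite_Card_order_limit[OF card_r inf_r assms] that by (auto simp: lt_iff)

lemma greater2_exists:
  assumes "a \<in> Field r" "b \<in> Field r"
  obtains c where "c \<in> Field r" "a \<sqsubset> c" "b \<sqsubset> c"
  by (metis assms greater_exists le_cases le_lt_trans)

lemma succ_exists:
  assumes "a \<in> Field r"
  obtains b where "is_succ_of r b a"
proof -
  obtain b0 where "a \<sqsubset> b0" "b0 \<in> Field r" by (rule greater_exists[OF assms])
  then obtain b where "a \<sqsubset> b" "\<forall>c\<in>Field r. a \<sqsubset> c \<longrightarrow> b \<sqsubseteq> c"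
    using least_exists[of b0 "\<lambda>b. a \<sqsubset> b"] by blast
  then show ?thesis using that[of b] lt_asym lt_Field unfolding is_succ_of_def ord_lt_iff by blast
qed

lemma Field_cases:
  assumes "a \<in> Field r"
  obtains (limit) "is_limit r a" | (succ) b where "is_succ_of r a b" "\<not> is_limit r a"
  using assms unfolding is_limit_def by blast

subsection \<open>Limit points of cofinality \<open>\<nu>\<close>\<close>

abbreviation cof_nu :: "'a \<Rightarrow> bool" where "cof_nu a \<equiv> cof_eq r n a"

text \<open>Take \<open>h\<close> such that \<open>D\<close> and \<open>E\<close> both meet every
  interval from \<open>a\<close> to \<open>h a\<close>. A strictly increasing \<nu>-sequence above
  \<open>b\<close> that jumps over \<open>h\<close> at each step has a supremum that is a limit
  point of both sets, and its cofinality is \<nu> because \<nu> is regular.\<close>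

lemma common_limit_point:
  assumes D: "unbounded_in r (Field r) D" "D \<subseteq> Field r"
    and E: "unbounded_in r (Field r) E" "E \<subseteq> Field r" and b: "b \<in> Field r"
  obtains d where "b \<sqsubset> d" "cof_nu d" "is_limit_point r D d" "is_limit_point r E d"
proof -
  have "\<exists>y. y \<in> Field r \<and> (\<exists>u\<in>D. a \<sqsubset> u \<and> u \<sqsubset> y) \<and> (\<exists>v\<in>E. a \<sqsubset> v \<and> v \<sqsubset> y)"
    if a: "a \<in> Field r" for a
  proof -
    obtain a' where "a \<sqsubset> a'" "a' \<in> Field r" using greater_exists[OF a] by blast
    moreover obtain u v where "u \<in> D" "a' \<sqsubseteq> u" "v \<in> E" "a' \<sqsubseteq> v"
      using D(1) E(1) calculation(2) unfolding unbounded_in_def by blast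
    moreover obtain y where "y \<in> Field r" "u \<sqsubset> y" "v \<sqsubset> y"
      using greater2_exists[of u v] calculation(4,6) le_Field by blast
    ultimately show ?thesis using lt_le_trans by blast
  qed
  then obtain h where h: "\<And>a. a \<in> Field r \<Longrightarrow> h a \<in> Field r"
    "\<And>a. a \<in> Field r \<Longrightarrow> \<exists>u\<in>D. a \<sqsubset> u \<and> u \<sqsubset> h a"
    "\<And>a. a \<in> Field r \<Longrightarrow> \<exists>v\<in>E. a \<sqsubset> v \<and> v \<sqsubset> h a"
    by metis
  define bd where "bd A = (SOME y. y \<in> Field r \<and> (\<forall>a\<in>A. a \<sqsubset> y))" for A
  have bd: "bd A \<in> Field r \<and> (\<forall>a\<in>A. a \<sqsubset> bd A)" if "A \<subseteq> Field r" "|A| \<le>o n" for A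
    unfolding bd_def by (rule someI_ex) (metis bounded[OF that])
  \<comment> \<open>Recursion along \<open>n\<close>: \<open>d i\<close> lies above \<open>b\<close>
    and above \<open>h (d j)\<close> for all \<open>j\<close> below \<open>i\<close>. These are at
    most \<nu> many points, so a bound exists below \<kappa>.\<close>
  define H where "H f i = bd (insert b (h ` f ` underS n i))" for f :: "'b \<Rightarrow> 'a" and i
  define d where "d = wo_rel.worec n H"
  have adm: "wo_rel.adm_wo n H"
    unfolding wo_rel.adm_wo_def[OF N.wo] H_def by (metis (no_types, lifting) image_cong)
  have d_eq: "d i = bd (insert b (h ` d ` underS n i))" for i
    unfolding d_def by (subst wo_rel.worec_fixpoint[OF N.wo adm]) (simp add: H_def)
  have small: "|underS n i| \<le>o n" if "i \<in> Field n" for i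
    using card_of_underS[OF card_n that] ordLess_imp_ordLeq by blast
  have small': "|insert b (h ` d ` underS n i)| \<le>o n" if "i \<in> Field n" for i
  proof -
    have "|h ` d ` underS n i| \<le>o n"
      using small[OF that] card_of_image ordLeq_transitive by metis
    moreover have "|{b}| \<le>o n"
      using card_of_singl_ordLeq[of "Field n" b] inf_n card_of_Field_ordIso[OF card_n]
        ordLeq_ordIso_trans by fastforce
    ultimately show ?thesis
      using card_of_Un_ordLeq_infinite_Field[OF inf_n _ _ card_n, of "{b}"] by simp
  qed
  have dF: "d i \<in> Field r" if "i \<in> Field n" for i
    using that
  proof (induction rule: N.lt_induct)
    case (less i)
    then have "insert b (h ` d ` underS n i) \<subseteq> Field r" using h(1) b by auto
    then show ?case using bd[OF _ small'[OF less(1)]] by (subst d_eq) blast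
  qed
  have sub: "insert b (h ` d ` underS n i) \<subseteq> Field r" if "i \<in> Field n" for i
    using h(1) b dF N.lt_Field(1) by auto
  have b_d: "b \<sqsubset> d i" if "i \<in> Field n" for i
    using bd[OF sub[OF that] small'[OF that]] by (subst d_eq) blast
  have h_d: "h (d j) \<sqsubset> d i" if "N.lt j i" for i j
    using bd[OF sub small', of i] that N.lt_Field(2)[OF that] by (subst (2) d_eq) blast
  have a_h: "a \<sqsubset> h a" if "a \<in> Field r" for a using h(2)[OF that] lt_trans by blast
  have mono: "d j \<sqsubset> d i" if "N.lt j i" for i j
    using h_d[OF that] a_h[OF dF[OF N.lt_Field(1)[OF that]]] lt_trans by blast
  have le_mono: "d j \<sqsubseteq> d i" if "N.le j i" for i j
    using mono[of j i] that N.lt_iff N.le_Field le_refl dF lt_le by metis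
  let ?A = "d ` Field n"
  have AF: "?A \<subseteq> Field r" using dF by blast
  have "|?A| \<le>o n"
    using card_of_image[of d "Field n"] card_of_Field_ordIso[OF card_n] ordLeq_ordIso_trans by blast
  then obtain u where u: "u \<in> Field r" "\<And>a. a \<in> ?A \<Longrightarrow> a \<sqsubset> u"
    using bounded[OF AF] by blast
  then have u': "\<forall>a\<in>?A. a \<sqsubseteq> u" using lt_le by blast
  define e where "e = lub ?A"
  have under: "underS r e = (\<Union>a\<in>?A. underS r a)"
    unfolding e_def by (rule underS_lub[OF u(1) u'])
  have next_i: "\<exists>i'. N.lt i i' \<and> i' \<in> Field n" if "i \<in> Field n" for i
    using infinite_Card_order_limit[OF card_n inf_n that] by (auto simp: N.lt_iff)
  have d_e: "d i \<sqsubset> e" if "i \<in> Field n" for i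
    using next_i[OF that] mono under by blast
  have lim: "is_limit_point r X e"
    if X: "\<forall>a\<in>Field r. \<exists>u\<in>X. a \<sqsubset> u \<and> u \<sqsubset> h a" for X
    unfolding limit_point_iff
  proof (intro conjI allI impI)
    obtain i where "i \<in> Field n" using inf_n by fastforce
    then show "underS r e \<noteq> {}" using d_e by blast
    fix c assume "c \<sqsubset> e"
    then obtain i where i: "i \<in> Field n" "c \<sqsubset> d i" using under by blast
    obtain i' where i': "N.lt i i'" "i' \<in> Field n" using next_i[OF i(1)] by blast
    obtain x where x: "x \<in> X" "d i \<sqsubset> x" "x \<sqsubset> h (d i)" using X dF[OF i(1)] by blast
    have "h (d i) \<sqsubset> e" using h_d[OF i'(1)] d_e[OF i'(2)] lt_trans by blast
    then show "\<exists>x\<in>X. c \<sqsubset> x \<and> x \<sqsubset> e" using x i lt_trans by blast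
  qed
  have "cof_nu e"
    unfolding cof_eq_def
  proof (intro conjI allI impI)
    have inj: "inj_on d (Field n)"
      by (rule inj_onI) (metis N.lt_cases lt_irrefl mono)
    have "|?A| =o n"
      using card_of_ordIso inj_on_imp_bij_betw[OF inj] ordIso_symmetric
        card_of_Field_ordIso[OF card_n] ordIso_transitive by metis
    moreover have "unbounded_in r (underS r e) ?A"
      unfolding unbounded_in_def using under lt_le by blast
    ultimately show "\<exists>A\<subseteq>underS r e. unbounded_in r (underS r e) A \<and> |A| =o n"
      using d_e by blast
    \<comment> \<open>Sending each point of \<open>B\<close> to an index whose
      \<open>d\<close>-value exceeds it gives a cofinal set of indices, which has size \<nu> by
      regularity of \<nu>.\<close>
    fix B assume B: "B \<subseteq> underS r e \<and> unbounded_in r (underS r e) B"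
    then have "\<forall>b\<in>B. \<exists>i\<in>Field n. b \<sqsubset> d i" using under by blast
    then obtain g where g: "\<And>b. b \<in> B \<Longrightarrow> g b \<in> Field n" "\<And>b. b \<in> B \<Longrightarrow> b \<sqsubset> d (g b)"
      by metis
    have "cofinal (g ` B) n"
      unfolding cofinal_def
    proof
      fix i assume i: "i \<in> Field n"
      then obtain b where b: "b \<in> B" "d i \<sqsubseteq> b" using B d_e unfolding unbounded_in_def by blast
      then have "d i \<sqsubset> d (g b)" using g(2) le_lt_trans by blast
      then have "\<not> N.le (g b) i" using le_mono lt_asym by blast
      then have "N.lt i (g b)" using N.not_le g(1)[OF b(1)] i by blast
      then show "\<exists>j\<in>g ` B. i \<noteq> j \<and> N.le i j" using b N.lt_iff by blast
    qed
    then have "|g ` B| =o n" using reg_n g(1) unfolding regularCard_def by blast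
    then show "n \<le>o |B|"
      using card_of_image[of g B] ordIso_ordLeq_trans ordIso_symmetric by blast
  qed
  moreover obtain i where "i \<in> Field n" using inf_n by fastforce
  then have "b \<sqsubset> e" using b_d d_e lt_trans by blast
  ultimately show ?thesis using that lim[of D] lim[of E] h(2,3) by blast
qed

text \<open>Enumerate \<open>a\<close> along \<nu> and keep only the record values of the
  enumeration. The records are unbounded, but below any \<open>b\<close> less than \<open>a\<close>
  there are fewer than \<nu> of them, so no such \<open>b\<close> is a limit point of cofinality
  \<nu>. The closure of the records is the desired club.\<close>

lemma thin_club:
  assumes lim: "is_limit r a"
  obtains L where "club_in r (underS r a) L"
    "\<And>b. b \<sqsubset> a \<Longrightarrow> is_limit_point r L b \<Longrightarrow> \<not> cof_nu b"
proof (cases "underS r a = {}")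
  case True
  then show ?thesis
    using that[of "{}"] by (simp add: club_in_def unbounded_in_def closed_in_ord_def)
next
  case False
  have aF: "a \<in> Field r" using lim by (simp add: is_limit_def)
  have "|underS r a| \<le>o |Field n|"
    using card_underS[OF aF] card_of_Field_ordIso[OF card_n] ordIso_symmetric ordLeq_ordIso_trans by blast
  then obtain p where p: "p ` Field n = underS r a" using iffD2[OF card_of_ordLeq2[OF False]] by metis
  \<comment> \<open>\<open>B\<close> consists of the values that exceed all values at earlier
    indices.\<close>
  define B where "B = {p i | i. i \<in> Field n \<and> (\<forall>j. N.lt j i \<longrightarrow> p j \<sqsubset> p i)}"
  define L where "L = B \<union> {b. b \<sqsubset> a \<and> is_limit_point r B b}"
  have Ba: "B \<subseteq> underS r a" using p B_def by auto
  have B_unb: "\<exists>c\<in>B. b \<sqsubseteq> c" if b: "b \<sqsubset> a" for b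
  proof -
    obtain i0 where "i0 \<in> Field n" "p i0 = b" using p b by (metis imageE)
    then have "b \<sqsubseteq> p i0" using le_refl lt_Field(1)[OF b] by blast
    \<comment> \<open>The first index at which \<open>p\<close> reaches \<open>b\<close> is a
      record.\<close>
    then obtain i where i: "i \<in> Field n" "b \<sqsubseteq> p i" and
      least: "\<forall>j\<in>Field n. b \<sqsubseteq> p j \<longrightarrow> N.le i j"
      using N.least_exists[of i0 "\<lambda>i. b \<sqsubseteq> p i"] \<open>i0 \<in> Field n\<close> by blast
    have "p j \<sqsubset> p i" if j: "N.lt j i" for j
    proof -
      have jF: "j \<in> Field n" using N.lt_Field(1)[OF j] .
      then have "\<not> b \<sqsubseteq> p j" using least j N.lt_asym by blast
      moreover have "p j \<in> Field r" using p jF lt_Field(1) by blast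
      ultimately have "p j \<sqsubset> b" using not_le lt_Field(1)[OF b] by blast
      then show ?thesis using i lt_le_trans by blast
    qed
    then have "p i \<in> B" using i unfolding B_def by blast
    then show ?thesis using i by blast
  qed
  have "club_in r (underS r a) L"
    unfolding club_in_def
  proof (intro conjI)
    show "L \<subseteq> underS r a" using Ba unfolding L_def by blast
    show "unbounded_in r (underS r a) L" using B_unb unfolding unbounded_in_def L_def by blast
    show "closed_in_ord r (underS r a) L"
      unfolding closed_in_ord_def L_def using limit_point_limit_points by blast
  qed
  moreover have "\<not> cof_nu b" if b: "b \<sqsubset> a" and "is_limit_point r L b" for b
  proof
    assume cof: "cof_nu b"
    have lb: "is_limit_point r B b" using limit_point_limit_points that(2) unfolding L_def by blast
    obtain c where "c \<in> B" "b \<sqsubseteq> c" using B_unb[OF b] by blast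
    then obtain i0 where i0: "i0 \<in> Field n" "b \<sqsubseteq> p i0" "\<And>j. N.lt j i0 \<Longrightarrow> p j \<sqsubset> p i0"
      unfolding B_def by blast
    \<comment> \<open>Since \<open>p i0\<close> is a record at or above \<open>b\<close>, the
      records below \<open>b\<close> occur at earlier indices, so there are fewer than \<nu> of
      them.\<close>
    have "B \<inter> underS r b \<subseteq> p ` underS n i0"
    proof
      fix x assume "x \<in> B \<inter> underS r b"
      then obtain i where i: "x = p i" "i \<in> Field n" "\<And>j. N.lt j i \<Longrightarrow> p j \<sqsubset> p i" "p i \<sqsubset> b"
        unfolding B_def by blast
      have "N.lt i i0"
        using i i0 N.lt_cases[OF i(2) i0(1)] by (metis lt_asym lt_le_trans lt_le)
      then show "x \<in> p ` underS n i0" using i by blast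
    qed
    then have "|B \<inter> underS r b| \<le>o |p ` underS n i0|" by (rule card_of_mono1)
    also have "|p ` underS n i0| \<le>o |underS n i0|" by (rule card_of_image)
    finally have "|B \<inter> underS r b| <o n"
      using card_of_underS[OF card_n i0(1)] ordLeq_ordLess_trans by blast
    moreover have "n \<le>o |B \<inter> underS r b|"
      using cof lb unfolding cof_eq_def is_limit_point_def by blast
    ultimately show False using not_ordLess_ordLeq by blast
  qed
  ultimately show ?thesis using that by blast
qed


subsection \<open>Coherent sequences and their topology\<close>

text \<open>Coherence localised at one index: it involves \<open>c\<close> only up to and including
  \<open>a\<close>, so sequences can be built and checked value by value.\<close>

definition coh :: "('a \<Rightarrow> 'a set) \<Rightarrow> 'a \<Rightarrow> bool" where
  "coh c a \<longleftrightarrow> (is_limit r a \<longrightarrow> club_in r (underS r a) (c a)) \<and> (\<forall>b. is_succ_of r a b \<longrightarrow> c a = {b})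
    \<and> (\<forall>b. b \<sqsubset> a \<longrightarrow> is_limit_point r (c a) b \<longrightarrow> cof_nu b \<longrightarrow> c b = c a \<inter> underS r b)"

lemma nu_coherent_iff:
  "nu_coherent r n D c \<longleftrightarrow> (\<forall>a\<in>D. coh c a) \<and> (\<forall>a. a \<notin> D \<longrightarrow> c a = {})"
proof -
  have "(\<forall>b. b \<sqsubset> a \<longrightarrow> is_limit_point r (c a) b \<longrightarrow> cof_nu b \<longrightarrow> c b = c a \<inter> underS r b) \<longleftrightarrow>
      (\<forall>b. b \<sqsubset> a \<and> is_limit_point r (c a) b \<and> cof_nu b \<longrightarrow> c b = c a \<inter> underS r b)" for a
    by metis
  then show ?thesis unfolding nu_coherent_def Cseq_def coh_def by (simp add: ball_conj_distrib conj_ac)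
qed

lemma Coh_iff: "c \<in> Coh r n \<longleftrightarrow> (\<forall>a\<in>Field r. coh c a) \<and> (\<forall>a. a \<notin> Field r \<longrightarrow> c a = {})"
  by (simp add: Coh_def nu_coherent_iff)

lemma coh_cong:
  assumes "a \<in> Field r" "\<forall>b. b \<sqsubseteq> a \<longrightarrow> c b = c' b"
  shows "coh c a = coh c' a"
proof -
  have "c a = c' a" using assms le_refl by blast
  moreover have "c b = c' b" if "b \<sqsubset> a" for b using that assms(2) lt_le by blast
  ultimately show ?thesis unfolding coh_def by auto
qed

lemma coh_coherent:
  "coh c a \<Longrightarrow> b \<sqsubset> a \<Longrightarrow> is_limit_point r (c a) b \<Longrightarrow> cof_nu b \<Longrightarrow> c b = c a \<inter> underS r b"
  by (simp add: coh_def)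

lemma coh_subset:
  assumes "coh c a" "a \<in> Field r"
  shows "c a \<subseteq> underS r a"
  using assms(2)
proof (cases rule: Field_cases)
  case limit
  then show ?thesis using assms by (simp add: coh_def club_in_def)
next
  case (succ b)
  then show ?thesis using assms by (auto simp: coh_def is_succ_iff)
qed

text \<open>A default value that is always admissible: having no limit points of cofinality \<nu>
  below \<open>a\<close>, it imposes no condition on earlier values.\<close>

definition ladder :: "'a \<Rightarrow> 'a set" where
  "ladder a = (if is_limit r a
     then (SOME L. club_in r (underS r a) L \<and> (\<forall>b. b \<sqsubset> a \<longrightarrow> is_limit_point r L b \<longrightarrow> \<not> cof_nu b))
     else {SOME b. is_succ_of r a b})"

lemma ladder_limit:
  assumes "is_limit r a"
  shows "club_in r (underS r a) (ladder a)"
    and "b \<sqsubset> a \<Longrightarrow> is_limit_point r (ladder a) b \<Longrightarrow> \<not> cof_nu b"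
proof -
  let ?P = "\<lambda>L. club_in r (underS r a) L \<and> (\<forall>b. b \<sqsubset> a \<longrightarrow> is_limit_point r L b \<longrightarrow> \<not> cof_nu b)"
  have "\<exists>L. ?P L" by (rule thin_club[OF assms]) blast
  then have "?P (SOME L. ?P L)" by (rule someI_ex)
  then have "?P (ladder a)" using assms by (simp add: ladder_def)
  then show "club_in r (underS r a) (ladder a)"
    and "b \<sqsubset> a \<Longrightarrow> is_limit_point r (ladder a) b \<Longrightarrow> \<not> cof_nu b" by auto
qed

lemma ladder_succ:
  assumes "is_succ_of r a b"
  shows "ladder a = {b}"
proof -
  have "(SOME b. is_succ_of r a b) = b" using assms is_succ_unique by blast
  then show ?thesis using assms by (auto simp: ladder_def is_limit_def)
qed

lemma coh_ladder:
  assumes "c a = ladder a" "a \<in> Field r"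
  shows "coh c a"
  using assms(2)
proof (cases rule: Field_cases)
  case limit
  then show ?thesis using ladder_limit[OF limit] assms unfolding coh_def is_limit_def by auto
next
  case (succ b)
  have "\<not> is_limit_point r {b} d" if "d \<sqsubset> a" for d
    using succ that unfolding limit_point_iff is_succ_iff
    by (metis all_not_in_conv lt_asym singletonD)
  moreover have "c a = {b}" using assms(1) ladder_succ succ by simp
  ultimately show ?thesis using succ is_succ_unique unfolding coh_def by auto
qed

text \<open>Ladders put on the indices outside \<open>I\<close> create no obligations towards the
  values on \<open>I\<close>. Hence every coherent sequence on an initial segment is part of one of
  full length.\<close>

lemma ladder_extension:
  assumes I: "I \<subseteq> Field r" "\<forall>a\<in>I. underS r a \<subseteq> I" and c: "\<forall>a\<in>I. coh c a"
  shows "(\<lambda>a. if a \<in> I then c a else if a \<in> Field r then ladder a else {}) \<in> Coh r n"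
proof -
  let ?C = "\<lambda>a. if a \<in> I then c a else if a \<in> Field r then ladder a else {}"
  have "coh ?C a" if a: "a \<in> Field r" for a
  proof (cases "a \<in> I")
    case True
    then have "b \<in> I" if "b \<sqsubseteq> a" for b using that I lt_iff by blast
    then have "coh ?C a = coh c a" by (intro coh_cong[OF a]) simp
    then show ?thesis using True c by blast
  next
    case False
    then show ?thesis using a by (intro coh_ladder) auto
  qed
  then show ?thesis using I(1) unfolding Coh_iff by auto
qed

text \<open>The value \<open>{}\<close> from \<open>g\<close> on is the normalisation required by
  \<open>nu_coherent\<close>.\<close>

definition cut :: "'a \<Rightarrow> ('a \<Rightarrow> 'a set) \<Rightarrow> 'a \<Rightarrow> 'a set" where
  "cut g c = (\<lambda>a. if a \<sqsubset> g then c a else {})"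

lemma coh_cut: "a \<sqsubset> g \<Longrightarrow> coh (cut g c) a = coh c a"
  by (intro coh_cong) (auto simp: cut_def lt_Field intro: le_lt_trans)

lemma nu_coherent_cut:
  assumes "c \<in> Coh r n"
  shows "nu_coherent r n (underS r g) (cut g c)"
proof -
  have "coh (cut g c) a" if "a \<sqsubset> g" for a
    using assms lt_Field(1)[OF that] unfolding coh_cut[OF that] Coh_iff by blast
  then show ?thesis unfolding nu_coherent_iff by (simp add: cut_def)
qed

lemma open_ball:
  assumes "C \<in> Coh r n" "g \<in> Field r"
  shows "openin (Coh_top r n) {C' \<in> Coh r n. \<forall>a\<in>underS r g. C' a = C a}"
proof -
  have "{C' \<in> Coh r n. \<forall>a\<in>underS r g. C' a = C a} =
      {C' \<in> Coh r n. \<forall>a\<in>underS r g. C' a = cut g C a}"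
    by (simp add: cut_def)
  then show ?thesis
    unfolding Coh_top_def
    by (intro topology_generated_by_Basis) (use nu_coherent_cut[OF assms(1)] assms(2) in blast)
qed

lemma least_elem: obtains z where "z \<in> Field r" "underS r z = {}"
proof -
  obtain x where "x \<in> Field r" using inf_r by fastforce
  then obtain z where "z \<in> Field r" "\<forall>s\<in>Field r. z \<sqsubseteq> s"
    using least_exists[of x "\<lambda>_. True"] by blast
  then show ?thesis using that[of z] lt_asym lt_Field(1) by blast
qed

lemma topspace_Coh: "topspace (Coh_top r n) = Coh r n"
proof
  show "topspace (Coh_top r n) \<subseteq> Coh r n" unfolding Coh_top_def by auto
  obtain z where "z \<in> Field r" by (rule least_elem)
  then show "Coh r n \<subseteq> topspace (Coh_top r n)"
    using open_ball[THEN openin_subset] by blast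
qed

text \<open>Induction on the generation of the topology. The only point is that two balls around
  \<open>C\<close> contain a third one of greater length, so the generating sets form a
  base.\<close>

lemma open_contains_ball:
  assumes "openin (Coh_top r n) T" "C \<in> T"
  shows "\<exists>g\<in>Field r. \<forall>C'\<in>Coh r n. (\<forall>a. a \<sqsubset> g \<longrightarrow> C' a = C a) \<longrightarrow> C' \<in> T"
proof -
  have "generate_topology_on {{C \<in> Coh r n. \<forall>a\<in>underS r g. C a = c a} | g c.
        g \<in> Field r \<and> nu_coherent r n (underS r g) c} T"
    using assms(1) unfolding Coh_top_def by (rule openin_topology_generated_by)
  then show ?thesis
    using assms(2)
  proof (induction rule: generate_topology_on.induct)
    case Empty
    then show ?case by simp
  next
    case (Int A B)
    then obtain g h where gh: "g \<in> Field r" "h \<in> Field r"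
      "\<forall>C'\<in>Coh r n. (\<forall>a. a \<sqsubset> g \<longrightarrow> C' a = C a) \<longrightarrow> C' \<in> A"
      "\<forall>C'\<in>Coh r n. (\<forall>a. a \<sqsubset> h \<longrightarrow> C' a = C a) \<longrightarrow> C' \<in> B" by auto
    obtain k where "k \<in> Field r" "g \<sqsubset> k" "h \<sqsubset> k" by (rule greater2_exists[OF gh(1,2)])
    have "C' \<in> A \<inter> B" if C': "C' \<in> Coh r n" "\<forall>a. a \<sqsubset> k \<longrightarrow> C' a = C a" for C'
    proof -
      have "\<forall>a. a \<sqsubset> g \<longrightarrow> C' a = C a" "\<forall>a. a \<sqsubset> h \<longrightarrow> C' a = C a"
        using C'(2) lt_trans[OF _ \<open>g \<sqsubset> k\<close>] lt_trans[OF _ \<open>h \<sqsubset> k\<close>] by auto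
      then show ?thesis using gh(3,4) C'(1) by simp
    qed
    then show ?case using \<open>k \<in> Field r\<close> by metis
  next
    case (UN K)
    then obtain X where "X \<in> K" "C \<in> X" by blast
    then obtain g where "g \<in> Field r" "\<forall>C'\<in>Coh r n. (\<forall>a. a \<sqsubset> g \<longrightarrow> C' a = C a) \<longrightarrow> C' \<in> X"
      using UN.IH by meson
    then show ?case using \<open>X \<in> K\<close> by (metis UnionI)
  next
    case (Basis S)
    then obtain g c where "g \<in> Field r" "S = {C \<in> Coh r n. \<forall>a\<in>underS r g. C a = c a}" by blast
    then show ?case using Basis.prems by (intro bexI[of _ g]) auto
  qed
qed

text \<open>No ball lies in the closure of \<open>N\<close>, so some \<open>C'\<close> in the ball
  around \<open>C\<close> has a neighbourhood missing \<open>N\<close>. Avoidance of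
  \<open>N\<close> is thus decided by an initial segment, which later extensions preserve.\<close>

lemma nowhere_dense_avoid:
  assumes N: "nowhere_dense (Coh_top r n) N" and C: "C \<in> Coh r n" and g: "g \<in> Field r"
  obtains C' g' where "C' \<in> Coh r n" "\<forall>a. a \<sqsubset> g \<longrightarrow> C' a = C a" "g \<sqsubset> g'"
    "\<forall>C''\<in>Coh r n. (\<forall>a. a \<sqsubset> g' \<longrightarrow> C'' a = C' a) \<longrightarrow> C'' \<notin> N"
proof -
  let ?X = "Coh_top r n"
  let ?B = "{C' \<in> Coh r n. \<forall>a\<in>underS r g. C' a = C a}"
  have "\<not> ?B \<subseteq> ?X closure_of N"
  proof
    assume "?B \<subseteq> ?X closure_of N"
    then have "?B \<subseteq> ?X interior_of (?X closure_of N)"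
      by (rule interior_of_maximal[OF _ open_ball[OF C g]])
    then show False using N C unfolding nowhere_dense_def by blast
  qed
  then obtain C' where C': "C' \<in> ?B" "C' \<notin> ?X closure_of N" by blast
  then obtain T where T: "openin ?X T" "C' \<in> T" "T \<inter> N = {}"
    unfolding in_closure_of topspace_Coh by blast
  obtain h where h: "h \<in> Field r" "\<forall>C''\<in>Coh r n. (\<forall>a. a \<sqsubset> h \<longrightarrow> C'' a = C' a) \<longrightarrow> C'' \<in> T"
    using open_contains_ball[OF T(1,2)] by blast
  obtain g' where "g' \<in> Field r" "g \<sqsubset> g'" "h \<sqsubset> g'" by (rule greater2_exists[OF g h(1)])
  have "C'' \<notin> N" if C'': "C'' \<in> Coh r n" "\<forall>a. a \<sqsubset> g' \<longrightarrow> C'' a = C' a" for C''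
  proof -
    have "\<forall>a. a \<sqsubset> h \<longrightarrow> C'' a = C' a" using C''(2) lt_trans[OF _ \<open>h \<sqsubset> g'\<close>] by simp
    then have "C'' \<in> T" using h(2) C''(1) by simp
    then show ?thesis using T(3) by blast
  qed
  then show ?thesis using C' \<open>g \<sqsubset> g'\<close> by (intro that[of C' g']) simp_all
qed

subsection \<open>Threads\<close>

definition thread :: "('a \<Rightarrow> 'a set) \<Rightarrow> 'a set \<Rightarrow> bool" where
  "thread c D \<longleftrightarrow> club_in r (Field r) D \<and>
    (\<forall>d. is_limit_point r D d \<longrightarrow> cof_nu d \<longrightarrow> c d = D \<inter> underS r d)"

lemma thread_club:
  assumes "thread c D"
  shows "unbounded_in r (Field r) D" "D \<subseteq> Field r" "is_limit_point r D d \<Longrightarrow> d \<in> D"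
  using assms unfolding thread_def club_in_def closed_in_ord_def
  by (auto dest: limit_point_Field)

lemma thread_unique:
  assumes D: "thread c D" and E: "thread c E"
  shows "D = E"
proof -
  have "D \<inter> underS r a = E \<inter> underS r a" if a: "a \<in> Field r" for a
  proof -
    obtain d where d: "a \<sqsubset> d" "cof_nu d" "is_limit_point r D d" "is_limit_point r E d"
      by (rule common_limit_point[OF thread_club(1,2)[OF D] thread_club(1,2)[OF E] a])
    then have "D \<inter> underS r d = E \<inter> underS r d" using D E unfolding thread_def by metis
    then show ?thesis using d(1) lt_trans by blast
  qed
  moreover have "\<exists>a\<in>Field r. x \<sqsubset> a" if "x \<in> Field r" for x
    using greater_exists[OF that] by blast
  ultimately show ?thesis using thread_club(2)[OF D] thread_club(2)[OF E] by blast
qed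

text \<open>A thread witnesses triviality, since it has arbitrarily large limit points of cofinality
  \<nu>. Conversely let \<open>C\<close> witness triviality. At each limit point \<open>d\<close> of
  \<open>C\<close> of cofinality \<nu>, coherence with a covering value gives that
  \<open>c d\<close> contains \<open>C\<close> below \<open>d\<close>; hence these values cohere
  with each other, and their union is a thread, in general larger than \<open>C\<close>.\<close>

lemma Triv_iff: "c \<in> Triv r n \<longleftrightarrow> c \<in> Coh r n \<and> (\<exists>D. thread c D)"
proof
  assume c: "c \<in> Coh r n \<and> (\<exists>D. thread c D)"
  then obtain D where D: "thread c D" by blast
  have "\<exists>b\<in>Field r. a \<sqsubseteq> b \<and> D \<inter> underS r a \<subseteq> c b" if a: "a \<in> Field r" for a
  proof -
    obtain d where d: "a \<sqsubset> d" "cof_nu d" "is_limit_point r D d"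
      by (rule common_limit_point[OF thread_club(1,2)[OF D] thread_club(1,2)[OF D] a])
    then have "c d = D \<inter> underS r d" using D unfolding thread_def by blast
    then show ?thesis using d(1) lt_Field(2)[OF d(1)] lt_le lt_trans by blast
  qed
  then show "c \<in> Triv r n" using c D unfolding Triv_def thread_def by blast
next
  assume "c \<in> Triv r n"
  then obtain C where c: "c \<in> Coh r n" and C: "club_in r (Field r) C"
    and cov: "\<forall>a\<in>Field r. \<exists>b\<in>Field r. a \<sqsubseteq> b \<and> C \<inter> underS r a \<subseteq> c b"
    unfolding Triv_def by blast
  have coh: "coh c a" if "a \<in> Field r" for a using c that unfolding Coh_iff by blast
  define L where "L = {d. is_limit_point r C d \<and> cof_nu d}"
  have LF: "d \<in> Field r" if "d \<in> L" for d using that limit_point_Field unfolding L_def by blast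
  have L_unb: "\<exists>d\<in>L. a \<sqsubset> d" if a: "a \<in> Field r" for a
  proof -
    have "unbounded_in r (Field r) C" "C \<subseteq> Field r" using C unfolding club_in_def by auto
    from common_limit_point[OF this this a] obtain d where
      "a \<sqsubset> d" "cof_nu d" "is_limit_point r C d" by blast
    then show ?thesis unfolding L_def by blast
  qed
  have C_sub: "C \<inter> underS r d \<subseteq> c d" if d: "d \<in> L" for d
  proof -
    \<comment> \<open>Covering at some \<open>a\<close> above \<open>d\<close> makes the index
      \<open>b\<close> strictly larger than \<open>d\<close>, so that coherence of
      \<open>c b\<close> at \<open>d\<close> applies.\<close>
    obtain a where a: "d \<sqsubset> a" "a \<in> Field r" by (rule greater_exists[OF LF[OF d]])
    obtain b where b: "b \<in> Field r" "a \<sqsubseteq> b" "C \<inter> underS r a \<subseteq> c b" using cov a(2) by blast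
    have db: "d \<sqsubset> b" using a b lt_le_trans by blast
    have sub: "C \<inter> underS r d \<subseteq> c b" using a(1) b(3) lt_trans by blast
    then have "is_limit_point r (c b) d" using d limit_point_mono unfolding L_def by blast
    then have "c d = c b \<inter> underS r d" using coh_coherent[OF coh[OF b(1)] db] d unfolding L_def by simp
    then show ?thesis using sub by blast
  qed
  have cd: "c d \<subseteq> underS r d" "club_in r (underS r d) (c d)" if "d \<in> L" for d
  proof -
    have "is_limit r d" using that limit_point_is_limit unfolding L_def by blast
    then show "club_in r (underS r d) (c d)" using coh[OF LF[OF that]] unfolding coh_def by blast
    then show "c d \<subseteq> underS r d" unfolding club_in_def by blast
  qed
  have coherent: "c d = c e \<inter> underS r d" if "d \<in> L" "e \<in> L" "d \<sqsubset> e" for d e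
  proof -
    \<comment> \<open>As \<open>c e\<close> contains \<open>C\<close> below \<open>e\<close>, every
      limit point of \<open>C\<close> below \<open>e\<close> is also one of
      \<open>c e\<close>.\<close>
    have "C \<inter> underS r d \<subseteq> c e" using C_sub[OF that(2)] lt_trans[OF _ that(3)] by blast
    then have "is_limit_point r (c e) d" using that limit_point_mono unfolding L_def by blast
    then show ?thesis using coh_coherent[OF coh[OF LF[OF that(2)]] that(3)] that(1) unfolding L_def by simp
  qed
  define D where "D = (\<Union>d\<in>L. c d)"
  have D_eq: "D \<inter> underS r d = c d" if d: "d \<in> L" for d
  proof
    show "c d \<subseteq> D \<inter> underS r d" using cd(1)[OF d] d unfolding D_def by blast
    show "D \<inter> underS r d \<subseteq> c d"
    proof
      fix x assume "x \<in> D \<inter> underS r d"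
      then obtain e where e: "e \<in> L" "x \<in> c e" "x \<sqsubset> d" unfolding D_def by blast
      show "x \<in> c d"
        using lt_cases[OF LF[OF d] LF[OF e(1)]] coherent[OF d e(1)] coherent[OF e(1) d] e by blast
    qed
  qed
  have "thread c D"
    unfolding thread_def club_in_def
  proof (intro conjI allI impI)
    show "D \<subseteq> Field r" using cd(1) lt_Field(1) unfolding D_def by blast
    show "unbounded_in r (Field r) D"
      unfolding unbounded_in_def
    proof
      fix a assume "a \<in> Field r"
      then obtain d where d: "d \<in> L" "a \<sqsubset> d" using L_unb by blast
      then obtain x where "x \<in> c d" "a \<sqsubseteq> x" using cd(2) unfolding club_in_def unbounded_in_def by blast
      then show "\<exists>x\<in>D. a \<sqsubseteq> x" using d unfolding D_def by blast
    qed
    \<comment> \<open>A limit point of the union is already a limit point of a single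
      \<open>c d\<close>; closure and the thread condition are then inherited from that
      \<open>c d\<close>.\<close>
    have lim_c: "\<exists>d\<in>L. b \<sqsubset> d \<and> is_limit_point r (c d) b" if b: "is_limit_point r D b" for b
    proof -
      obtain d where d: "d \<in> L" "b \<sqsubset> d" using L_unb[OF limit_point_Field[OF b]] by blast
      have "D \<inter> underS r b \<subseteq> c d" using D_eq[OF d(1)] lt_trans[OF _ d(2)] by blast
      then show ?thesis using b d limit_point_mono by blast
    qed
    show "closed_in_ord r (Field r) D"
      unfolding closed_in_ord_def
    proof (intro ballI impI)
      fix b assume "is_limit_point r D b"
      then obtain d where d: "d \<in> L" "b \<sqsubset> d" "is_limit_point r (c d) b" using lim_c by blast
      then have "b \<in> c d" using cd(2) unfolding club_in_def closed_in_ord_def by blast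
      then show "b \<in> D" using d unfolding D_def by blast
    qed
    fix b assume b: "is_limit_point r D b" "cof_nu b"
    then obtain d where d: "d \<in> L" "b \<sqsubset> d" "is_limit_point r (c d) b" using lim_c by blast
    then have "c b = c d \<inter> underS r b" using coh_coherent[OF coh[OF LF[OF d(1)]]] b(2) by simp
    then show "c b = D \<inter> underS r b" using D_eq[OF d(1)] lt_trans[OF _ d(2)] by blast
  qed
  then show "c \<in> Coh r n \<and> (\<exists>D. thread c D)" using c by blast
qed

subsection \<open>Nodes\<close>

text \<open>A node \<open>(\<gamma>, c, D)\<close> consists of a coherent sequence \<open>c\<close> of length \<open>\<gamma>\<close> and a closed
  \<open>D \<subseteq> \<gamma>\<close>; the parameter \<open>Q\<close> constrains the values of \<open>c\<close> at the limit points of \<open>D\<close>.\<close>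

type_synonym 'x node = "'x \<times> ('x \<Rightarrow> 'x set) \<times> 'x set"

abbreviation lev :: "'x node \<Rightarrow> 'x" where "lev p \<equiv> fst p"
abbreviation sq :: "'x node \<Rightarrow> 'x \<Rightarrow> 'x set" where "sq p \<equiv> fst (snd p)"
abbreviation pt :: "'x node \<Rightarrow> 'x set" where "pt p \<equiv> snd (snd p)"

text \<open>Stated for any initial segment \<open>I\<close>, because it is applied to the length of
  a node and also to all of \<open>Field r\<close> at the end of a run. The clause
  \<open>a \<in> D\<close> makes \<open>D\<close> closed in \<open>I\<close>.\<close>

definition good :: "('a \<Rightarrow> 'a set \<Rightarrow> 'a set \<Rightarrow> bool) \<Rightarrow> 'a set \<Rightarrow> ('a \<Rightarrow> 'a set) \<Rightarrow> 'a set \<Rightarrow> bool" where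
  "good Q I c D \<longleftrightarrow> D \<subseteq> I \<and>
    (\<forall>a\<in>I. coh c a \<and> (is_limit_point r D a \<longrightarrow> a \<in> D \<and> Q a (D \<inter> underS r a) (c a))) \<and>
    (\<forall>a. a \<notin> I \<longrightarrow> c a = {})"

definition node :: "('a \<Rightarrow> 'a set \<Rightarrow> 'a set \<Rightarrow> bool) \<Rightarrow> 'a node \<Rightarrow> bool" where
  "node Q p \<longleftrightarrow> lev p \<in> Field r \<and> good Q (underS r (lev p)) (sq p) (pt p)"

definition ext :: "'a node \<Rightarrow> 'a node \<Rightarrow> bool" where
  "ext p q \<longleftrightarrow> lev p \<sqsubseteq> lev q \<and> (\<forall>a. a \<sqsubset> lev p \<longrightarrow> sq q a = sq p a) \<and>
    pt q \<inter> underS r (lev p) = pt p"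

text \<open>In \<open>next_node Q p q\<close> the set of \<open>q\<close> arises from that of \<open>p\<close> by adding the level of \<open>p\<close>.
  At level \<open>0\<close> this is optional: a thread may or may not contain \<open>0\<close>.\<close>

definition next_node :: "('a \<Rightarrow> 'a set \<Rightarrow> 'a set \<Rightarrow> bool) \<Rightarrow> 'a node \<Rightarrow> 'a node \<Rightarrow> bool" where
  "next_node Q p q \<longleftrightarrow> node Q q \<and> ext p q \<and> lev p \<sqsubset> lev q \<and> pt q \<subseteq> insert (lev p) (pt p) \<and>
    (underS r (lev p) \<noteq> {} \<longrightarrow> lev p \<in> pt q)"

text \<open>Meant for chains. The pointwise union of the sequences is correct since each is empty
  beyond its length.\<close>

definition join :: "'a node set \<Rightarrow> 'a node" where
  "join S = (lub (lev ` S), \<lambda>a. \<Union>p\<in>S. sq p a, \<Union>p\<in>S. pt p)"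

lemma node_Field: "node Q p \<Longrightarrow> lev p \<in> Field r"
  by (simp add: node_def)

lemma node_pt: "node Q p \<Longrightarrow> pt p \<subseteq> underS r (lev p)"
  by (simp add: node_def good_def)

lemma node_sq: "node Q p \<Longrightarrow> \<not> a \<sqsubset> lev p \<Longrightarrow> sq p a = {}"
  by (simp add: node_def good_def)

lemma ext_trans:
  assumes "ext p q" "ext q s"
  shows "ext p s"
proof -
  have "lev p \<sqsubseteq> lev s" using assms le_trans unfolding ext_def by blast
  moreover have sub: "underS r (lev p) \<subseteq> underS r (lev q)"
    using assms(1) underS_mono unfolding ext_def by blast
  ultimately show ?thesis using assms unfolding ext_def by blast
qed

lemma ext_refl: "node Q p \<Longrightarrow> ext p p"
  using node_pt le_refl node_Field unfolding ext_def by blast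

text \<open>The nodes of a chain agree wherever they are defined, so the unions restrict to each of
  them. Every condition of \<open>good\<close> at \<open>a\<close> depends only on data up to
  \<open>a\<close>, hence is inherited from any node of level above \<open>a\<close>. The levels may
  be unbounded, as for a complete run.\<close>

lemma chain_union:
  assumes K: "\<forall>p\<in>K. node Q p" and ch: "\<forall>p\<in>K. \<forall>q\<in>K. ext p q \<or> ext q p"
  defines "c \<equiv> \<lambda>a. \<Union>p\<in>K. sq p a" and "D \<equiv> \<Union>p\<in>K. pt p"
  shows chain_sq: "p \<in> K \<Longrightarrow> a \<sqsubset> lev p \<Longrightarrow> c a = sq p a"
    and chain_pt: "p \<in> K \<Longrightarrow> D \<inter> underS r (lev p) = pt p"
    and chain_good: "good Q (\<Union>p\<in>K. underS r (lev p)) c D"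
proof -
  have sq: "c a = sq p a" if p: "p \<in> K" "a \<sqsubset> lev p" for p a
  proof -
    have "sq q a \<subseteq> sq p a" if q: "q \<in> K" for q
    proof (cases "a \<sqsubset> lev q")
      case True
      then show ?thesis using ch p q unfolding ext_def by blast
    next
      case False
      then show ?thesis using K q node_sq by blast
    qed
    then show ?thesis using p unfolding c_def by blast
  qed
  have pt: "D \<inter> underS r (lev p) = pt p" if p: "p \<in> K" for p
  proof -
    have "pt q \<inter> underS r (lev p) \<subseteq> pt p" if q: "q \<in> K" for q
      using ch p q unfolding ext_def by blast
    moreover have "pt p \<subseteq> underS r (lev p)" using K p node_pt by blast
    ultimately show ?thesis using p unfolding D_def by blast
  qed
  show "p \<in> K \<Longrightarrow> a \<sqsubset> lev p \<Longrightarrow> c a = sq p a" by (rule sq)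
  show "p \<in> K \<Longrightarrow> D \<inter> underS r (lev p) = pt p" by (rule pt)
  show "good Q (\<Union>p\<in>K. underS r (lev p)) c D"
    unfolding good_def
  proof (intro conjI ballI allI)
    show "D \<subseteq> (\<Union>p\<in>K. underS r (lev p))" unfolding D_def using K node_pt by blast
    fix a
    show "a \<notin> (\<Union>p\<in>K. underS r (lev p)) \<longrightarrow> c a = {}" unfolding c_def using K node_sq by blast
    assume "a \<in> (\<Union>p\<in>K. underS r (lev p))"
    then obtain p where p: "p \<in> K" "a \<sqsubset> lev p" by blast
    have g: "good Q (underS r (lev p)) (sq p) (pt p)" using K p(1) unfolding node_def by blast
    have "\<forall>b. b \<sqsubseteq> a \<longrightarrow> c b = sq p b" using sq[OF p(1)] le_lt_trans[OF _ p(2)] by simp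
    then have "coh c a = coh (sq p) a" by (rule coh_cong[OF lt_Field(1)[OF p(2)]])
    then show "coh c a" using g p(2) unfolding good_def by blast
    have eq: "D \<inter> underS r a = pt p \<inter> underS r a" using pt[OF p(1)] lt_trans[OF _ p(2)] by blast
    have "a \<in> D \<and> Q a (D \<inter> underS r a) (c a)" if "is_limit_point r D a"
    proof -
      have "is_limit_point r (pt p) a" using that limit_point_cong[OF eq] by blast
      then have "a \<in> pt p \<and> Q a (pt p \<inter> underS r a) (sq p a)" using g p(2) unfolding good_def by blast
      then show ?thesis using eq sq[OF p] p(1) unfolding D_def by auto
    qed
    then show "is_limit_point r D a \<longrightarrow> a \<in> D \<and> Q a (D \<inter> underS r a) (c a)" by blast
  qed
qed

lemma join_node:
  assumes K: "\<forall>p\<in>K. node Q p" and ch: "\<forall>p\<in>K. \<forall>q\<in>K. ext p q \<or> ext q p"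
    and u: "u \<in> Field r" "\<forall>p\<in>K. lev p \<sqsubseteq> u"
  shows "node Q (join K)" and "p \<in> K \<Longrightarrow> ext p (join K)"
proof -
  have u': "\<forall>a\<in>lev ` K. a \<sqsubseteq> u" using u by blast
  have under: "underS r (lub (lev ` K)) = (\<Union>p\<in>K. underS r (lev p))"
    using underS_lub[OF u(1) u'] by simp
  show "node Q (join K)"
    unfolding node_def join_def using lub_Field[OF u(1) u'] chain_good[OF K ch] by (simp add: under)
  assume p: "p \<in> K"
  show "ext p (join K)"
    unfolding ext_def join_def fst_conv snd_conv
  proof (intro conjI allI impI)
    show "lev p \<sqsubseteq> lub (lev ` K)" using lub_upper[OF u(1) u'] p by blast
    show "\<And>a. a \<sqsubset> lev p \<Longrightarrow> (\<Union>p\<in>K. sq p a) = sq p a" by (rule chain_sq[OF K ch p])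
    show "(\<Union>p\<in>K. pt p) \<inter> underS r (lev p) = pt p" by (rule chain_pt[OF K ch p])
  qed
qed

text \<open>Only \<open>lev p\<close> brings a new obligation: limit points below it are those of
  \<open>pt p\<close>, and above it the new set has no elements to accumulate. Beyond
  \<open>lev p\<close> the sequence may therefore follow any \<open>C\<close>.\<close>

lemma next_node_extension:
  assumes p: "node Q p" and C: "C \<in> Coh r n" "\<forall>a. a \<sqsubset> lev p \<longrightarrow> C a = sq p a"
    and Q: "is_limit_point r (pt p) (lev p) \<longrightarrow> Q (lev p) (pt p) (C (lev p))"
    and g: "lev p \<sqsubset> g"
  shows "next_node Q p (g, cut g C, insert (lev p) (pt p))"
proof -
  let ?l = "lev p" and ?D = "insert (lev p) (pt p)"
  have pl: "pt p \<subseteq> underS r ?l" using node_pt[OF p] .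
  have "good Q (underS r g) (cut g C) ?D"
    unfolding good_def
  proof (intro conjI ballI allI impI)
    show "?D \<subseteq> underS r g" using pl g lt_trans[OF _ g] by blast
    fix a
    show "a \<notin> underS r g \<Longrightarrow> cut g C a = {}" by (simp add: cut_def)
    assume a: "a \<sqsubset> g"
    show "coh (cut g C) a" using a C(1) lt_Field(1)[OF a] unfolding coh_cut[OF a] Coh_iff by blast
    assume lim: "is_limit_point r ?D a"
    have "a \<in> ?D \<and> Q a (?D \<inter> underS r a) (C a)"
      using lt_Field(1)[OF a] node_Field[OF p]
    proof (cases rule: lt_cases)
      case 1
      then have eq: "?D \<inter> underS r a = pt p \<inter> underS r a" using lt_asym lt_le by blast
      then have "is_limit_point r (pt p) a" using lim limit_point_cong by blast
      then have "a \<in> pt p \<and> Q a (pt p \<inter> underS r a) (sq p a)"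
        using p 1 unfolding node_def good_def by blast
      then show ?thesis using eq C(2) 1 by auto
    next
      case 2
      then have eq: "?D \<inter> underS r a = pt p" using pl by auto
      moreover have "pt p \<inter> underS r a = pt p" using pl 2 by auto
      ultimately have "is_limit_point r (pt p) ?l" using lim limit_point_cong[of ?D a "pt p"] 2 by auto
      then show ?thesis using Q eq 2 by auto
    next
      case 3
      then obtain x where "x \<in> ?D" "?l \<sqsubset> x" using lim unfolding limit_point_iff by blast
      then have False using pl lt_asym lt_le lt_irrefl by blast
      then show ?thesis ..
    qed
    then show "a \<in> ?D" "Q a (?D \<inter> underS r a) (cut g C a)" using a by (auto simp: cut_def)
  qed
  then have "node Q (g, cut g C, ?D)" using lt_Field(2)[OF g] by (simp add: node_def)
  moreover have "ext p (g, cut g C, ?D)"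
    using C(2) g lt_le pl lt_trans[OF _ g] unfolding ext_def by (auto simp: cut_def)
  ultimately show ?thesis using g unfolding next_node_def by auto
qed


subsection \<open>Transfinite runs\<close>

text \<open>\<open>S\<close> is a strategy that sees the stage and the current node. Taking the join
  of all earlier moves treats zero, successor and limit stages uniformly.\<close>

definition run :: "('a \<Rightarrow> 'a node \<Rightarrow> 'a node) \<Rightarrow> 'a \<Rightarrow> 'a node" where
  "run S = wo_rel.worec r (\<lambda>f x. join ((\<lambda>y. S y (f y)) ` underS r x))"

lemma run_eq: "run S x = join ((\<lambda>y. S y (run S y)) ` underS r x)"
proof -
  let ?H = "\<lambda>f x. join ((\<lambda>y. S y (f y)) ` underS r x)"
  have "wo_rel.adm_wo r ?H"
    unfolding wo_rel.adm_wo_def[OF wo]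
  proof (intro allI impI)
    fix f g :: "'a \<Rightarrow> 'a node" and x assume "\<forall>y\<in>underS r x. f y = g y"
    then have "(\<lambda>y. S y (f y)) ` underS r x = (\<lambda>y. S y (g y)) ` underS r x" by auto
    then show "?H f x = ?H g x" by simp
  qed
  from wo_rel.worec_fixpoint[OF wo this] show ?thesis unfolding run_def by metis
qed

text \<open>Only the moves at nodes actually visited before stage \<open>x\<close> matter. This
  yields continuity of the coding and allows a strategy to be replaced by a walk making the same
  moves.\<close>

lemma run_cong:
  assumes "x \<in> Field r" "\<forall>y. y \<sqsubset> x \<longrightarrow> S y (run S y) = S' y (run S y)"
  shows "run S x = run S' x"
  using assms
proof (induction rule: lt_induct)
  case (less x)
  have "S y (run S y) = S' y (run S' y)" if y: "y \<sqsubset> x" for y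
  proof -
    have "run S y = run S' y" by (rule less.IH[OF y]) (use less.prems lt_trans[OF _ y] in blast)
    moreover have "S y (run S y) = S' y (run S y)" using less.prems y by blast
    ultimately show ?thesis by argo
  qed
  then have "(\<lambda>y. S y (run S y)) ` underS r x = (\<lambda>y. S' y (run S' y)) ` underS r x"
    by (rule image_cong[OF refl])
  then show ?case unfolding run_eq[of S x] run_eq[of S' x] by (rule arg_cong)
qed

definition legal :: "('a \<Rightarrow> 'a set \<Rightarrow> 'a set \<Rightarrow> bool) \<Rightarrow> ('a \<Rightarrow> 'a node \<Rightarrow> 'a node) \<Rightarrow> bool" where
  "legal Q S \<longleftrightarrow> (\<forall>x\<in>Field r. \<forall>p. node Q p \<longrightarrow> next_node Q p (S x p))"

definition seq_of :: "('a \<Rightarrow> 'a node \<Rightarrow> 'a node) \<Rightarrow> 'a \<Rightarrow> 'a set" where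
  "seq_of S a = (\<Union>p\<in>(\<lambda>y. S y (run S y)) ` Field r. sq p a)"

definition path_of :: "('a \<Rightarrow> 'a node \<Rightarrow> 'a node) \<Rightarrow> 'a set" where
  "path_of S = (\<Union>p\<in>(\<lambda>y. S y (run S y)) ` Field r. pt p)"

lemma legal_next: "legal Q S \<Longrightarrow> x \<in> Field r \<Longrightarrow> node Q p \<Longrightarrow> next_node Q p (S x p)"
  unfolding legal_def by blast

text \<open>What \<open>run_node_ext\<close> proves by induction is an assumption here, so the lemma
  serves inside that induction with \<open>X = underS r x\<close> and afterwards with
  \<open>X = Field r\<close>.\<close>

lemma run_chain:
  assumes S: "legal Q S" and X: "X \<subseteq> Field r"
    and IH: "\<forall>y\<in>X. node Q (run S y) \<and> (\<forall>z. z \<sqsubset> y \<longrightarrow> ext (S z (run S z)) (run S y))"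
  shows "\<forall>p\<in>(\<lambda>y. S y (run S y)) ` X. node Q p"
    and "\<forall>p\<in>(\<lambda>y. S y (run S y)) ` X. \<forall>q\<in>(\<lambda>y. S y (run S y)) ` X. ext p q \<or> ext q p"
proof -
  have nx: "next_node Q (run S y) (S y (run S y))" if "y \<in> X" for y
    using legal_next[OF S] X IH that by blast
  then show "\<forall>p\<in>(\<lambda>y. S y (run S y)) ` X. node Q p" unfolding next_node_def by blast
  have up: "ext (S y (run S y)) (S z (run S z))" if "y \<in> X" "z \<in> X" "y \<sqsubset> z" for y z
    using IH that nx[OF that(2)] ext_trans unfolding next_node_def by blast
  have "ext (S y (run S y)) (S z (run S z)) \<or> ext (S z (run S z)) (S y (run S y))"
    if "y \<in> X" "z \<in> X" for y z
  proof -
    have "y \<in> Field r" "z \<in> Field r" using that X by auto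
    then show ?thesis
    proof (cases rule: lt_cases)
      case 2
      then show ?thesis using ext_refl nx[OF that(1)] unfolding next_node_def by blast
    qed (use up[OF that] up[OF that(2,1)] in blast)+
  qed
  then show "\<forall>p\<in>(\<lambda>y. S y (run S y)) ` X. \<forall>q\<in>(\<lambda>y. S y (run S y)) ` X. ext p q \<or> ext q p"
    by blast
qed

text \<open>At stage \<open>x\<close> at most \<nu> moves have been made, so by regularity of
  \<kappa> their levels are bounded and the join is again a node.\<close>

lemma run_node_ext:
  assumes S: "legal Q S" and x: "x \<in> Field r"
  shows "node Q (run S x) \<and> (\<forall>y. y \<sqsubset> x \<longrightarrow> ext (S y (run S y)) (run S x))"
  using x
proof (induction rule: lt_induct)
  case (less x)
  let ?K = "(\<lambda>y. S y (run S y)) ` underS r x"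
  have sub: "underS r x \<subseteq> Field r" using lt_Field(1) by blast
  have "\<forall>y\<in>underS r x. node Q (run S y) \<and> (\<forall>z. z \<sqsubset> y \<longrightarrow> ext (S z (run S z)) (run S y))"
    using less.IH by simp
  note ch = run_chain[OF S sub this]
  have "|lev ` ?K| \<le>o |underS r x|" unfolding image_image by (rule card_of_image)
  then have "|lev ` ?K| \<le>o n" using card_underS[OF less.hyps] ordLeq_transitive by blast
  moreover have "lev ` ?K \<subseteq> Field r" using ch(1) node_Field by blast
  ultimately obtain u where "u \<in> Field r" "\<And>a. a \<in> lev ` ?K \<Longrightarrow> a \<sqsubset> u" using bounded by metis
  then have u: "u \<in> Field r" "\<forall>p\<in>?K. lev p \<sqsubseteq> u" using lt_le by auto
  show ?case unfolding run_eq[of S x] using join_node[OF ch u] by blast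
qed

lemmas run_node = run_node_ext[THEN conjunct1]

lemma run_next: "legal Q S \<Longrightarrow> x \<in> Field r \<Longrightarrow> next_node Q (run S x) (S x (run S x))"
  by (simp add: legal_next run_node)

text \<open>If the level \<open>y\<close> at stage \<open>x\<close> were below \<open>x\<close>, the
  move at stage \<open>y\<close> would start at level at least \<open>y\<close> and end above
  \<open>y\<close>, although the node at stage \<open>x\<close> extends its result.\<close>

lemma run_level:
  assumes S: "legal Q S" and x: "x \<in> Field r"
  shows "x \<sqsubseteq> lev (run S x)"
  using x
proof (induction rule: lt_induct)
  case (less x)
  show ?case
  proof (rule ccontr)
    let ?y = "lev (run S x)"
    assume "\<not> x \<sqsubseteq> ?y"
    then have y: "?y \<sqsubset> x" using not_le less.hyps node_Field[OF run_node[OF S less.hyps]] by blast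
    have "?y \<sqsubseteq> lev (run S ?y)" using less.IH[OF y] .
    also have "lev (run S ?y) \<sqsubset> lev (S ?y (run S ?y))"
      using run_next[OF S lt_Field(1)[OF y]] unfolding next_node_def by blast
    finally (le_lt_trans) have "?y \<sqsubset> lev (S ?y (run S ?y))" .
    moreover have "lev (S ?y (run S ?y)) \<sqsubseteq> ?y"
      using run_node_ext[OF S less.hyps] y unfolding ext_def by blast
    ultimately show False using lt_asym by blast
  qed
qed

lemma seq_of_props:
  assumes S: "legal Q S"
  shows seq_of_step: "x \<in> Field r \<Longrightarrow> a \<sqsubset> lev (S x (run S x)) \<Longrightarrow> seq_of S a = sq (S x (run S x)) a"
    and path_of_step: "x \<in> Field r \<Longrightarrow> path_of S \<inter> underS r (lev (S x (run S x))) = pt (S x (run S x))"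
    and good_limit: "good Q (Field r) (seq_of S) (path_of S)"
proof -
  let ?K = "(\<lambda>y. S y (run S y)) ` Field r"
  note ch = run_chain[OF S subset_refl ballI[OF run_node_ext[OF S]]]
  show "x \<in> Field r \<Longrightarrow> a \<sqsubset> lev (S x (run S x)) \<Longrightarrow> seq_of S a = sq (S x (run S x)) a"
    unfolding seq_of_def by (rule chain_sq[OF ch]) auto
  show "x \<in> Field r \<Longrightarrow> path_of S \<inter> underS r (lev (S x (run S x))) = pt (S x (run S x))"
    unfolding path_of_def by (rule chain_pt[OF ch]) auto
  have "(\<Union>p\<in>?K. underS r (lev p)) = Field r"
  proof
    show "(\<Union>p\<in>?K. underS r (lev p)) \<subseteq> Field r" using lt_Field(1) by blast
    show "Field r \<subseteq> (\<Union>p\<in>?K. underS r (lev p))"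
    proof
      fix x assume x: "x \<in> Field r"
      then have "x \<sqsubset> lev (S x (run S x))"
        using run_level[OF S x] run_next[OF S x] le_lt_trans unfolding next_node_def by blast
      then show "x \<in> (\<Union>p\<in>?K. underS r (lev p))" using x by blast
    qed
  qed
  then show "good Q (Field r) (seq_of S) (path_of S)"
    using chain_good[OF ch] unfolding seq_of_def[abs_def] path_of_def by simp
qed

lemma seq_of_run:
  assumes S: "legal Q S" and x: "x \<in> Field r"
  shows "a \<sqsubset> lev (run S x) \<Longrightarrow> seq_of S a = sq (run S x) a"
proof -
  have e: "ext (run S x) (S x (run S x))" and l: "lev (run S x) \<sqsubset> lev (S x (run S x))"
    using run_next[OF S x] unfolding next_node_def by auto
  show "a \<sqsubset> lev (run S x) \<Longrightarrow> seq_of S a = sq (run S x) a"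
    using e l seq_of_step[OF S x] lt_trans unfolding ext_def by metis
qed

lemma seq_of_Coh: "legal Q S \<Longrightarrow> seq_of S \<in> Coh r n"
  using good_limit unfolding good_def Coh_iff by blast

lemma lev_run_in_path:
  assumes S: "legal Q S" and x: "x \<in> Field r" and "underS r (lev (run S x)) \<noteq> {}"
  shows "lev (run S x) \<in> path_of S"
  using run_next[OF S x] assms(3) path_of_step[OF S x] unfolding next_node_def by blast

lemma path_of_club:
  assumes S: "legal Q S"
  shows "club_in r (Field r) (path_of S)"
  unfolding club_in_def
proof (intro conjI)
  have g: "good Q (Field r) (seq_of S) (path_of S)" by (rule good_limit[OF S])
  then show "path_of S \<subseteq> Field r" unfolding good_def by blast
  show "closed_in_ord r (Field r) (path_of S)" using g unfolding closed_in_ord_def good_def by blast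
  show "unbounded_in r (Field r) (path_of S)"
    unfolding unbounded_in_def
  proof
    fix a assume "a \<in> Field r"
    then obtain b where b: "a \<sqsubset> b" "b \<in> Field r" by (rule greater_exists)
    have l: "a \<sqsubset> lev (run S b)" using b run_level[OF S b(2)] lt_le_trans by blast
    then have "lev (run S b) \<in> path_of S" using lev_run_in_path[OF S b(2)] by blast
    then show "\<exists>c\<in>path_of S. a \<sqsubseteq> c" using l lt_le by blast
  qed
qed

subsection \<open>Threaded and thin runs\<close>

definition thread_ok :: "'a \<Rightarrow> 'a set \<Rightarrow> 'a set \<Rightarrow> bool" where
  "thread_ok a D v \<longleftrightarrow> (cof_nu a \<longrightarrow> v = D)"

definition thin_ok :: "'a \<Rightarrow> 'a set \<Rightarrow> 'a set \<Rightarrow> bool" where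
  "thin_ok a D v \<longleftrightarrow> (\<forall>b. b \<sqsubset> a \<longrightarrow> is_limit_point r v b \<longrightarrow> \<not> cof_nu b)"

lemma thread_path_of:
  assumes "legal thread_ok S"
  shows "thread (seq_of S) (path_of S)"
  using path_of_club[OF assms] good_limit[OF assms] limit_point_Field
  unfolding thread_def good_def thread_ok_def by blast

text \<open>Given a thread \<open>D\<close>, pick a limit point \<open>d\<close> of \<open>D\<close>
  and above it a common limit point \<open>e\<close> of \<open>D\<close> and the path, both of
  cofinality \<nu>. The thread forces the value at \<open>e\<close> to be \<open>D\<close> below
  \<open>e\<close>, which accumulates at \<open>d\<close>; thinness at \<open>e\<close> forbids
  this.\<close>

lemma thin_seq_of_not_Triv:
  assumes S: "legal thin_ok S"
  shows "seq_of S \<notin> Triv r n"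
proof
  assume "seq_of S \<in> Triv r n"
  then obtain D where D: "thread (seq_of S) D" unfolding Triv_iff by blast
  have P: "unbounded_in r (Field r) (path_of S)" "path_of S \<subseteq> Field r"
    using path_of_club[OF S] unfolding club_in_def by auto
  obtain z where z: "z \<in> Field r" by (rule least_elem)
  obtain d where d: "z \<sqsubset> d" "cof_nu d" "is_limit_point r D d"
    by (rule common_limit_point[OF thread_club(1,2)[OF D] P z])
  obtain e where e: "d \<sqsubset> e" "cof_nu e" "is_limit_point r D e" "is_limit_point r (path_of S) e"
    by (rule common_limit_point[OF thread_club(1,2)[OF D] P limit_point_Field[OF d(3)]])
  have "seq_of S e = D \<inter> underS r e" using D e unfolding thread_def by blast
  then have "is_limit_point r (seq_of S e) d"
    using d(3) by (rule_tac limit_point_mono) (use lt_trans[OF _ e(1)] in auto)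
  moreover have "thin_ok e (path_of S \<inter> underS r e) (seq_of S e)"
    using good_limit[OF S] e(4) limit_point_Field unfolding good_def by blast
  ultimately show False using d(2) e(1) unfolding thin_ok_def by blast
qed

text \<open>A value chosen at \<open>lev p\<close> only has to fit the sequence below it; ladders
  fill the rest.\<close>

lemma node_value_extension:
  assumes p: "node Q p" and v: "coh ((sq p)(lev p := v)) (lev p)"
  shows "\<exists>C\<in>Coh r n. (\<forall>a. a \<sqsubset> lev p \<longrightarrow> C a = sq p a) \<and> C (lev p) = v"
proof -
  let ?l = "lev p" and ?c = "(sq p)(lev p := v)"
  let ?I = "insert ?l (underS r ?l)"
  let ?C = "\<lambda>a. if a \<in> ?I then ?c a else if a \<in> Field r then ladder a else {}"
  have "coh ?c a" if a: "a \<sqsubset> ?l" for a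
  proof -
    have "\<forall>b. b \<sqsubseteq> a \<longrightarrow> ?c b = sq p b" using le_lt_trans[OF _ a] lt_irrefl by (metis fun_upd_other)
    then have "coh ?c a = coh (sq p) a" by (rule coh_cong[OF lt_Field(1)[OF a]])
    then show ?thesis using p a unfolding node_def good_def by blast
  qed
  then have "\<forall>a\<in>?I. coh ?c a" using v by blast
  moreover have "?I \<subseteq> Field r" using node_Field[OF p] lt_Field(1) by blast
  moreover have "\<forall>a\<in>?I. underS r a \<subseteq> ?I" using lt_trans by blast
  ultimately have "?C \<in> Coh r n" by (intro ladder_extension)
  moreover have "\<forall>a. a \<sqsubset> ?l \<longrightarrow> ?C a = sq p a" "?C ?l = v" by auto
  ultimately show ?thesis by (intro bexI[of _ ?C] conjI)
qed

text \<open>The ladder at \<open>lev p\<close> is coherent with any sequence below and is thin. As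
  \<open>Q\<close> is arbitrary, \<open>thread_extension\<close> can also use this where
  \<open>lev p\<close> is no limit point of \<open>pt p\<close>.\<close>

lemma thin_extension:
  assumes p: "node Q p"
  shows "\<exists>C\<in>Coh r n. (\<forall>a. a \<sqsubset> lev p \<longrightarrow> C a = sq p a) \<and>
    (is_limit_point r (pt p) (lev p) \<longrightarrow> thin_ok (lev p) (pt p) (C (lev p)))"
proof -
  have "coh ((sq p)(lev p := ladder (lev p))) (lev p)"
    by (rule coh_ladder) (simp_all add: node_Field[OF p])
  then obtain C where "C \<in> Coh r n" "\<forall>a. a \<sqsubset> lev p \<longrightarrow> C a = sq p a" "C (lev p) = ladder (lev p)"
    using node_value_extension[OF p] by blast
  moreover have "is_limit_point r (pt p) (lev p) \<longrightarrow> thin_ok (lev p) (pt p) (ladder (lev p))"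
    using ladder_limit(2) limit_point_is_limit unfolding thin_ok_def by blast
  ultimately show ?thesis by metis
qed

text \<open>At a limit point of \<open>pt p\<close> the value \<open>pt p\<close> itself works: it
  is club because nodes have closed sets, and coherent because \<open>thread_ok\<close> at the
  smaller limit points of cofinality \<nu> is exactly the coherence condition.\<close>

lemma thread_extension:
  assumes p: "node thread_ok p"
  shows "\<exists>C\<in>Coh r n. (\<forall>a. a \<sqsubset> lev p \<longrightarrow> C a = sq p a) \<and>
    (is_limit_point r (pt p) (lev p) \<longrightarrow> thread_ok (lev p) (pt p) (C (lev p)))"
proof (cases "is_limit_point r (pt p) (lev p)")
  case False
  then show ?thesis using thin_extension[OF p] by blast
next
  case True
  have g: "good thread_ok (underS r (lev p)) (sq p) (pt p)" using p unfolding node_def by blast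
  have lim: "is_limit r (lev p)" by (rule limit_point_is_limit[OF True])
  have "coh ((sq p)(lev p := pt p)) (lev p)"
    unfolding coh_def
  proof (intro conjI allI impI)
    have "unbounded_in r (underS r (lev p)) (pt p)"
      using True unfolding is_limit_point_def unbounded_in_def by blast
    then show "club_in r (underS r (lev p)) (((sq p)(lev p := pt p)) (lev p))"
      using g unfolding club_in_def closed_in_ord_def good_def by simp
    show "\<And>b. is_succ_of r (lev p) b \<Longrightarrow> ((sq p)(lev p := pt p)) (lev p) = {b}"
      using lim unfolding is_limit_def by blast
    fix b assume b: "b \<sqsubset> lev p" "is_limit_point r (((sq p)(lev p := pt p)) (lev p)) b" "cof_nu b"
    then have "sq p b = pt p \<inter> underS r b" using g unfolding good_def thread_ok_def by auto
    then show "((sq p)(lev p := pt p)) b = ((sq p)(lev p := pt p)) (lev p) \<inter> underS r b"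
      using b(1) lt_irrefl by (metis fun_upd_apply)
  qed
  then obtain C where "C \<in> Coh r n" "\<forall>a. a \<sqsubset> lev p \<longrightarrow> C a = sq p a" "C (lev p) = pt p"
    using node_value_extension[OF p] by blast
  then show ?thesis unfolding thread_ok_def by blast
qed

subsection \<open>Counting the next nodes\<close>

text \<open>Here \<open>2^\<nu> = \<kappa>\<close> enters the count of next nodes.\<close>

lemma card_Pow:
  assumes "|X| \<le>o n"
  shows "|Pow X| \<le>o r"
proof -
  have "|X| \<le>o |Field n|"
    using assms card_of_Field_ordIso[OF card_n] ordIso_symmetric ordLeq_ordIso_trans by blast
  then obtain f where "inj_on f X" "f ` X \<subseteq> Field n" using iffD2[OF card_of_ordLeq] by metis
  then have "inj_on ((`) f) (Pow X)" "((`) f) ` Pow X \<subseteq> Pow (Field n)"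
    by (auto simp: inj_on_image_Pow)
  then have "|Pow X| \<le>o |Pow (Field n)|" using card_of_ordLeq by blast
  then show ?thesis using r_pow ordLeq_ordIso_trans by blast
qed

text \<open>A coherent value at \<open>a\<close> lies below \<open>a\<close>, so a node of level
  \<open>g\<close> is coded by the graph of its sequence, a relation on the at most \<nu> ordinals
  below \<open>g\<close>, together with a subset of \<open>g\<close>.\<close>

lemma card_nodes_at_level:
  assumes g: "g \<in> Field r"
  shows "|{q. node Q q \<and> lev q = g}| \<le>o r"
proof -
  let ?A = "underS r g" and ?S = "{q. node Q q \<and> lev q = g}"
  define f where "f q = ({(a, b). b \<in> sq q a}, pt q)" for q :: "'a node"
  have "inj_on f ?S"
  proof (rule inj_onI)
    fix p q assume pq: "p \<in> ?S" "q \<in> ?S" "f p = f q"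
    have "b \<in> sq p a \<longleftrightarrow> b \<in> sq q a" for a b using pq(3) unfolding f_def by blast
    then have "sq p = sq q" by blast
    then show "p = q" using pq unfolding f_def by (auto intro: prod_eqI)
  qed
  moreover have "f ` ?S \<subseteq> Pow (?A \<times> ?A) \<times> Pow ?A"
  proof
    fix y assume "y \<in> f ` ?S"
    then obtain q where q: "node Q q" "lev q = g" "y = f q" by blast
    have "a \<sqsubset> g \<and> b \<sqsubset> g" if "b \<in> sq q a" for a b
    proof -
      have a: "a \<sqsubset> g" using node_sq[OF q(1), of a] q(2) that by auto
      then have "coh (sq q) a" using q(1,2) unfolding node_def good_def by blast
      then have "b \<sqsubset> a" using coh_subset[OF _ lt_Field(1)[OF a]] that by blast
      then show ?thesis using a lt_trans by blast
    qed
    then show "y \<in> Pow (?A \<times> ?A) \<times> Pow ?A" using q node_pt[OF q(1)] unfolding f_def by auto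
  qed
  ultimately have "|?S| \<le>o |Pow (?A \<times> ?A) \<times> Pow ?A|" using card_of_ordLeq by blast
  moreover have "|?A| \<le>o n" by (rule card_underS[OF g])
  then have "|?A \<times> ?A| \<le>o n" using card_of_Times_ordLeq_infinite_Field[OF inf_n _ _ card_n] by blast
  then have "|Pow (?A \<times> ?A) \<times> Pow ?A| \<le>o r"
    by (rule card_of_Times_ordLeq_infinite_Field[OF inf_r card_Pow card_Pow[OF \<open>|?A| \<le>o n\<close>] card_r])
  ultimately show ?thesis using ordLeq_transitive by blast
qed

lemma card_above:
  assumes g: "g \<in> Field r"
  shows "r \<le>o |{h. g \<sqsubset> h}|"
proof (rule ccontr)
  assume "\<not> r \<le>o |{h. g \<sqsubset> h}|"
  then have "|{h. g \<sqsubset> h}| <o r" using well_r card_of_Well_order not_ordLeq_iff_ordLess by blast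
  then have "|{h. g \<sqsubset> h}| \<le>o n" using le_n_iff by blast
  moreover have "{h. g \<sqsubset> h} \<subseteq> Field r" using lt_Field(2) by blast
  ultimately obtain b where b: "b \<in> Field r" "\<And>a. a \<in> {h. g \<sqsubset> h} \<Longrightarrow> a \<sqsubset> b" using bounded by metis
  obtain c where "g \<sqsubset> c" "b \<sqsubset> c" by (rule greater2_exists[OF g b(1)])
  then show False using b(2)[of c] lt_asym lt_le by blast
qed

lemma next_node_at_level:
  assumes p: "node thread_ok p" and g: "lev p \<sqsubset> g"
  obtains q where "next_node thread_ok p q" "lev q = g"
proof -
  obtain C where "C \<in> Coh r n" "\<forall>a. a \<sqsubset> lev p \<longrightarrow> C a = sq p a"
    "is_limit_point r (pt p) (lev p) \<longrightarrow> thread_ok (lev p) (pt p) (C (lev p))"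
    using thread_extension[OF p] by blast
  from next_node_extension[OF p this g] show ?thesis by (rule that) simp
qed

lemma card_next_nodes:
  assumes p: "node thread_ok p"
  shows "|{q. next_node thread_ok p q}| =o r"
proof -
  let ?O = "{q. next_node thread_ok p q}"
  have "?O \<subseteq> (\<Union>g\<in>Field r. {q. node thread_ok q \<and> lev q = g})"
    using node_Field unfolding next_node_def by blast
  then have "|?O| \<le>o |\<Union>g\<in>Field r. {q. node thread_ok q \<and> lev q = g}|" by (rule card_of_mono1)
  moreover have "|\<Union>g\<in>Field r. {q. node thread_ok q \<and> lev q = g}| \<le>o r"
  proof (rule card_of_UNION_ordLeq_infinite_Field[OF inf_r card_r])
    show "|Field r| \<le>o r" using card_of_Field_ordIso[OF card_r] ordIso_imp_ordLeq by blast
  qed (use card_nodes_at_level in blast)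
  ultimately have le: "|?O| \<le>o r" using ordLeq_transitive by blast
  \<comment> \<open>For the lower bound, the \<kappa> many possible levels already give distinct
    next nodes.\<close>
  have "\<forall>g\<in>{h. lev p \<sqsubset> h}. \<exists>q. next_node thread_ok p q \<and> lev q = g"
    using next_node_at_level[OF p] by blast
  then obtain f where f: "\<And>g. lev p \<sqsubset> g \<Longrightarrow> next_node thread_ok p (f g) \<and> lev (f g) = g"
    by (metis mem_Collect_eq)
  then have "inj_on f {h. lev p \<sqsubset> h}" by (metis (mono_tags, lifting) inj_onI mem_Collect_eq)
  moreover have "f ` {h. lev p \<sqsubset> h} \<subseteq> ?O" using f by blast
  ultimately have "|{h. lev p \<sqsubset> h}| \<le>o |?O|" using card_of_ordLeq by blast
  then have "r \<le>o |?O|" using card_above[OF node_Field[OF p]] ordLeq_transitive by blast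
  then show ?thesis using le ordIso_iff_ordLeq by blast
qed


subsection \<open>Trivial sequences as a continuous injective image\<close>

text \<open>The bijection depends on the node alone, so two walks standing at the same node decode
  their letters in the same way.\<close>

definition code :: "'a node \<Rightarrow> 'a \<Rightarrow> 'a node" where
  "code p = (SOME e. bij_betw e (Field r) {q. next_node thread_ok p q})"

definition walk :: "('a \<Rightarrow> 'a) \<Rightarrow> 'a \<Rightarrow> 'a node \<Rightarrow> 'a node" where
  "walk x y p = code p (x y)"

lemma code_bij:
  assumes "node thread_ok p"
  shows "bij_betw (code p) (Field r) {q. next_node thread_ok p q}"
proof -
  have "|Field r| =o |{q. next_node thread_ok p q}|"
    using card_of_Field_ordIso[OF card_r] card_next_nodes[OF assms] ordIso_symmetric ordIso_transitive
    by metis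
  then have "\<exists>e. bij_betw e (Field r) {q. next_node thread_ok p q}" by (rule iffD2[OF card_of_ordIso])
  then show ?thesis unfolding code_def by (rule someI_ex)
qed

lemma walk_legal:
  assumes "\<forall>y\<in>Field r. x y \<in> Field r"
  shows "legal thread_ok (walk x)"
  unfolding legal_def walk_def
  using code_bij assms bij_betwE by blast

text \<open>The letters below \<open>g\<close> determine the node at stage \<open>g\<close>, whose
  level is at least \<open>g\<close>. This is the modulus of continuity.\<close>

lemma walk_local:
  assumes x: "\<forall>y\<in>Field r. x y \<in> Field r" and x': "\<forall>y\<in>Field r. x' y \<in> Field r"
    and g: "g \<in> Field r" and eq: "\<forall>a. a \<sqsubset> g \<longrightarrow> x a = x' a" and a: "a \<sqsubset> g"
  shows "seq_of (walk x) a = seq_of (walk x') a"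
proof -
  have run: "run (walk x) g = run (walk x') g"
    by (rule run_cong[OF g]) (simp add: walk_def eq)
  have "a \<sqsubset> lev (run (walk x) g)" using run_level[OF walk_legal[OF x] g] a lt_le_trans by blast
  then show ?thesis
    using seq_of_run[OF walk_legal[OF x] g] seq_of_run[OF walk_legal[OF x'] g] run by simp
qed

text \<open>The level reached at stage \<open>x\<close> is the level at the successor stage, where
  the next move puts it into the path. It is not 0, so the option at level 0 does not arise.\<close>

lemma lev_step_in_path:
  assumes S: "legal Q S" and x: "x \<in> Field r"
  shows "lev (S x (run S x)) \<in> path_of S"
proof -
  let ?l = "lev (S x (run S x))"
  have l: "lev (run S x) \<sqsubset> ?l" using run_next[OF S x] unfolding next_node_def by blast
  obtain y where y: "is_succ_of r y x" by (rule succ_exists[OF x])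
  have xy: "x \<sqsubset> y" using y by (simp add: is_succ_iff)
  have yF: "y \<in> Field r" using lt_Field(2)[OF xy] .
  have up: "?l \<sqsubseteq> lev (run S y)" using run_node_ext[OF S yF] xy unfolding ext_def by blast
  have "lev (S z (run S z)) \<sqsubseteq> ?l" if z: "z \<sqsubset> y" for z
  proof (cases "z = x")
    case True
    then show ?thesis using le_refl lt_Field(2)[OF l] by simp
  next
    case False
    then have "z \<sqsubset> x" using y z unfolding is_succ_iff lt_iff by blast
    then have "lev (S z (run S z)) \<sqsubseteq> lev (run S x)" using run_node_ext[OF S x] unfolding ext_def by blast
    then show ?thesis using l lt_le le_trans by blast
  qed
  then have le: "\<forall>a\<in>lev ` (\<lambda>z. S z (run S z)) ` underS r y. a \<sqsubseteq> ?l" by blast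
  have "lev (run S y) \<sqsubseteq> ?l"
    unfolding run_eq[of S y] join_def fst_conv
    using lub_least[OF _ le _ le] lt_Field(2)[OF l] by blast
  then have "lev (run S y) = ?l" using up le_antisym by blast
  then show ?thesis using lev_run_in_path[OF S yF] l by auto
qed

text \<open>The level reached by a step is the next element of the path after its start, hence can
  be read off the path. Below that level the node is a restriction of the final sequence and
  path.\<close>

lemma step_determined:
  assumes S: "legal Q S" and S': "legal Q S'" and x: "x \<in> Field r" and run: "run S x = run S' x"
    and sq: "seq_of S = seq_of S'" and pt: "path_of S = path_of S'"
  shows "S x (run S x) = S' x (run S' x)"
proof -
  let ?q = "S x (run S x)" and ?q' = "S' x (run S' x)"
  have nq: "next_node Q (run S x) ?q" and nq': "next_node Q (run S x) ?q'"
    using run_next[OF S x] run_next[OF S' x] run by auto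
  have node: "node Q ?q" "node Q ?q'" using nq nq' unfolding next_node_def by auto
  \<comment> \<open>If one step ended lower, its end would be a path element strictly between start
    and end of the other step; but a step adds at most its starting level. General \<open>T\<close>
    and \<open>T'\<close> allow use in both directions.\<close>
  have no: "\<not> lev (T x (run T x)) \<sqsubset> lev (T' x (run T' x))"
    if T: "legal Q T" "legal Q T'" "run T x = run T' x" "path_of T = path_of T'" for T T'
  proof
    assume less: "lev (T x (run T x)) \<sqsubset> lev (T' x (run T' x))"
    then have "lev (T x (run T x)) \<in> pt (T' x (run T' x))"
      using lev_step_in_path[OF T(1) x] path_of_step[OF T(2) x] T(4) by blast
    then have "lev (T x (run T x)) \<in> insert (lev (run T x)) (pt (run T x))"
      using run_next[OF T(2) x] T(3) unfolding next_node_def by auto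
    moreover have "lev (run T x) \<sqsubset> lev (T x (run T x))"
      using run_next[OF T(1) x] unfolding next_node_def by blast
    moreover have "pt (run T x) \<subseteq> underS r (lev (run T x))" by (rule node_pt[OF run_node[OF T(1) x]])
    ultimately consider "lev (run T x) \<sqsubset> lev (run T x)"
      | "lev (T x (run T x)) \<sqsubset> lev (run T x)" "lev (run T x) \<sqsubset> lev (T x (run T x))"
      by auto
    then show False by cases (simp, use lt_asym lt_le in blast)
  qed
  have lev: "lev ?q = lev ?q'"
    using lt_cases[OF node_Field[OF node(1)] node_Field[OF node(2)]]
      no[OF S S' run pt] no[OF S' S run[symmetric] pt[symmetric]] by blast
  have "pt ?q = pt ?q'" using path_of_step[OF S x] path_of_step[OF S' x] pt lev by simp
  moreover have "sq ?q a = sq ?q' a" for a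
  proof (cases "a \<sqsubset> lev ?q")
    case True
    then show ?thesis using seq_of_step[OF S x True] seq_of_step[OF S' x, of a] sq lev by simp
  next
    case False
    then show ?thesis using node_sq[OF node(1) False] node_sq[OF node(2), of a] lev by simp
  qed
  ultimately show ?thesis using lev by (intro prod_eqI) auto
qed

lemma topspace_Baire: "topspace (Baire_space r) = Field r \<rightarrow>\<^sub>E Field r"
proof
  show "topspace (Baire_space r) \<subseteq> Field r \<rightarrow>\<^sub>E Field r" unfolding Baire_space_def by auto
  obtain z where "z \<in> Field r" "underS r z = {}" by (rule least_elem)
  then have "{x \<in> Field r \<rightarrow>\<^sub>E Field r. \<forall>a\<in>underS r z. x a = x a} \<in>
     {{x \<in> Field r \<rightarrow>\<^sub>E Field r. \<forall>a\<in>underS r g. x a = s a} | g s.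
        g \<in> Field r \<and> s \<in> underS r g \<rightarrow> Field r}" by auto
  then show "Field r \<rightarrow>\<^sub>E Field r \<subseteq> topspace (Baire_space r)"
    unfolding Baire_space_def topology_generated_by_topspace by blast
qed

lemma open_Baire_ball:
  assumes "x \<in> Field r \<rightarrow>\<^sub>E Field r" "g \<in> Field r"
  shows "openin (Baire_space r) {y \<in> Field r \<rightarrow>\<^sub>E Field r. \<forall>a\<in>underS r g. y a = x a}"
proof -
  have "x \<in> underS r g \<rightarrow> Field r" using assms(1) lt_Field(1) by auto
  then show ?thesis
    unfolding Baire_space_def by (intro topology_generated_by_Basis) (use assms(2) in blast)
qed

lemma continuous_walk: "continuous_map (Baire_space r) (Coh_top r n) (\<lambda>x. seq_of (walk x))"
  unfolding Coh_top_def
proof (rule continuous_on_generated_topo)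
  let ?B = "{{C \<in> Coh r n. \<forall>a\<in>underS r g. C a = c a} | g c.
        g \<in> Field r \<and> nu_coherent r n (underS r g) c}"
  let ?f = "\<lambda>x. seq_of (walk x)"
  have "?f x \<in> Coh r n" if "x \<in> Field r \<rightarrow>\<^sub>E Field r" for x
    using seq_of_Coh walk_legal that by blast
  then have "?f ` topspace (Baire_space r) \<subseteq> topspace (Coh_top r n)"
    unfolding topspace_Baire topspace_Coh by blast
  then show "?f ` topspace (Baire_space r) \<subseteq> \<Union>?B"
    unfolding Coh_top_def topology_generated_by_topspace .
  fix U assume "U \<in> ?B"
  then obtain g c where U: "g \<in> Field r" "U = {C \<in> Coh r n. \<forall>a\<in>underS r g. C a = c a}" by blast
  show "openin (Baire_space r) (?f -` U \<inter> topspace (Baire_space r))"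
    unfolding topspace_Baire
  proof (subst openin_subopen, intro ballI)
    fix x assume x: "x \<in> ?f -` U \<inter> (Field r \<rightarrow>\<^sub>E Field r)"
    let ?N = "{y \<in> Field r \<rightarrow>\<^sub>E Field r. \<forall>a\<in>underS r g. y a = x a}"
    have "?f y \<in> U" if y: "y \<in> ?N" for y
    proof -
      have "seq_of (walk y) a = seq_of (walk x) a" if "a \<sqsubset> g" for a
        by (rule walk_local[OF _ _ U(1) _ that]) (use x y in auto)
      moreover have "seq_of (walk y) \<in> Coh r n" using seq_of_Coh walk_legal y by blast
      ultimately show ?thesis using x U(2) by auto
    qed
    then show "\<exists>T. openin (Baire_space r) T \<and> x \<in> T \<and> T \<subseteq> ?f -` U \<inter> (Field r \<rightarrow>\<^sub>E Field r)"
      using open_Baire_ball[OF _ U(1), of x] x by (intro exI[of _ ?N]) auto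
  qed
qed

text \<open>At the least \<open>b\<close> where \<open>x\<close> and \<open>y\<close> differ the two
  runs still agree. Equal sequences have equal threads, so the paths coincide, hence so do the moves
  at \<open>b\<close>, and injectivity of the code gives \<open>x b = y b\<close>.\<close>

lemma inj_walk: "inj_on (\<lambda>x. seq_of (walk x)) (Field r \<rightarrow>\<^sub>E Field r)"
proof (rule inj_onI, rule ccontr)
  fix x y
  assume x: "x \<in> Field r \<rightarrow>\<^sub>E Field r" and y: "y \<in> Field r \<rightarrow>\<^sub>E Field r"
    and eq: "seq_of (walk x) = seq_of (walk y)" and "x \<noteq> y"
  then obtain a where "a \<in> Field r" "x a \<noteq> y a" using PiE_ext by metis
  then obtain b where b: "b \<in> Field r" "x b \<noteq> y b" and least: "\<forall>s\<in>Field r. x s \<noteq> y s \<longrightarrow> b \<sqsubseteq> s"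
    using least_exists[of a "\<lambda>a. x a \<noteq> y a"] by blast
  have below: "x s = y s" if "s \<sqsubset> b" for s
    using least that lt_asym lt_Field(1) by blast
  have Lx: "legal thread_ok (walk x)" and Ly: "legal thread_ok (walk y)"
    using walk_legal x y by blast+
  have run: "run (walk x) b = run (walk y) b"
    by (rule run_cong[OF b(1)]) (simp add: walk_def below)
  have "path_of (walk x) = path_of (walk y)"
    using thread_unique thread_path_of[OF Lx] thread_path_of[OF Ly] eq by metis
  then have "code (run (walk x) b) (x b) = code (run (walk x) b) (y b)"
    using step_determined[OF Lx Ly b(1) run eq] run unfolding walk_def by simp
  moreover have "inj_on (code (run (walk x) b)) (Field r)"
    using code_bij[OF run_node[OF Lx b(1)]] bij_betw_def by blast
  ultimately show False using b x y unfolding inj_on_def by blast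
qed

lemma thread_good:
  assumes c: "c \<in> Coh r n" and D: "thread c D"
  shows "good thread_ok (Field r) c D"
  using c thread_club(2,3)[OF D] D unfolding good_def Coh_iff thread_ok_def thread_def by blast

lemma cut_node:
  assumes c: "c \<in> Coh r n" and D: "thread c D" and g: "g \<in> Field r"
  shows "node thread_ok (g, cut g c, D \<inter> underS r g)"
  unfolding node_def good_def fst_conv snd_conv
proof (intro conjI ballI allI impI)
  show "g \<in> Field r" "D \<inter> underS r g \<subseteq> underS r g" using g by auto
  fix a
  show "a \<notin> underS r g \<Longrightarrow> cut g c a = {}" by (simp add: cut_def)
  assume a: "a \<sqsubset> g"
  have good: "good thread_ok (Field r) c D" by (rule thread_good[OF c D])
  show "coh (cut g c) a" unfolding coh_cut[OF a] using good lt_Field(1)[OF a] unfolding good_def by blast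
  assume lim: "is_limit_point r (D \<inter> underS r g) a"
  then have "is_limit_point r D a" by (rule limit_point_mono) blast
  then have *: "a \<in> D \<and> thread_ok a (D \<inter> underS r a) (c a)"
    using good lt_Field(1)[OF a] unfolding good_def by blast
  then show "a \<in> D \<inter> underS r g" using a by blast
  have "D \<inter> underS r g \<inter> underS r a = D \<inter> underS r a" using lt_trans[OF _ a] by blast
  then show "thread_ok a (D \<inter> underS r g \<inter> underS r a) (cut g c a)" using * a by (simp add: cut_def)
qed

text \<open>\<open>h\<close> is the least element of \<open>D\<close> above \<open>g\<close>, so
  that exactly one level is passed in a step.\<close>

lemma cut_next_node:
  assumes c: "c \<in> Coh r n" and D: "thread c D" and g: "g \<in> Field r" "g \<in> D \<or> underS r g = {}"
  obtains h where "h \<in> D" "next_node thread_ok (g, cut g c, D \<inter> underS r g) (h, cut h c, D \<inter> underS r h)"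
proof -
  obtain g' where g': "g \<sqsubset> g'" "g' \<in> Field r" by (rule greater_exists[OF g(1)])
  then obtain h0 where "h0 \<in> D" "g' \<sqsubseteq> h0" using thread_club(1)[OF D] unfolding unbounded_in_def by blast
  then have "h0 \<in> Field r" "h0 \<in> D \<and> g \<sqsubset> h0" using g' lt_le_trans le_Field(2) by blast+
  then obtain h where h: "h \<in> Field r" "h \<in> D" "g \<sqsubset> h"
    and least: "\<forall>s\<in>Field r. s \<in> D \<and> g \<sqsubset> s \<longrightarrow> h \<sqsubseteq> s"
    using least_exists[of h0 "\<lambda>h. h \<in> D \<and> g \<sqsubset> h"] by blast
  have "D \<inter> underS r h \<subseteq> insert g (D \<inter> underS r g)"
  proof
    fix s assume s: "s \<in> D \<inter> underS r h"
    then have "\<not> g \<sqsubset> s" using least lt_asym lt_Field(1) by blast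
    then show "s \<in> insert g (D \<inter> underS r g)" using s lt_Field(1) g(1) lt_cases by blast
  qed
  moreover have "ext (g, cut g c, D \<inter> underS r g) (h, cut h c, D \<inter> underS r h)"
    unfolding ext_def fst_conv snd_conv cut_def using lt_le[OF h(3)] lt_trans[OF _ h(3)] by auto
  ultimately have "next_node thread_ok (g, cut g c, D \<inter> underS r g) (h, cut h c, D \<inter> underS r h)"
    unfolding next_node_def fst_conv snd_conv using cut_node[OF c D h(1)] h(3) g(2) by blast
  then show ?thesis using that h(2) by blast
qed

lemma next_node_exists: "node thread_ok p \<Longrightarrow> \<exists>q. next_node thread_ok p q"
  using greater_exists[OF node_Field] next_node_at_level by metis

text \<open>A strategy that moves from each element of the thread \<open>D\<close> to the next one
  reproduces \<open>c\<close>. Its moves are next nodes, so they can be decoded into a point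
  \<open>x\<close> whose walk has the same run.\<close>

lemma surj_walk:
  assumes "c \<in> Triv r n"
  shows "\<exists>x\<in>Field r \<rightarrow>\<^sub>E Field r. seq_of (walk x) = c"
proof -
  obtain D where c: "c \<in> Coh r n" and D: "thread c D" using assms Triv_iff by blast
  let ?\<rho> = "\<lambda>g. (g, cut g c, D \<inter> underS r g)"
  let ?on = "\<lambda>p. \<exists>g\<in>Field r. p = ?\<rho> g \<and> (g \<in> D \<or> underS r g = {})"
  \<comment> \<open>At nodes not cut out of \<open>(c, D)\<close> the move is an arbitrary next
    node; this keeps \<open>S\<close> legal everywhere.\<close>
  define S :: "'a \<Rightarrow> 'a node \<Rightarrow> 'a node" where
    "S y p = (SOME q. next_node thread_ok p q \<and> (?on p \<longrightarrow> (\<exists>h\<in>D. q = ?\<rho> h)))" for y p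
  have S_prop: "next_node thread_ok p (S y p) \<and> (?on p \<longrightarrow> (\<exists>h\<in>D. S y p = ?\<rho> h))"
    if p: "node thread_ok p" for y p
  proof -
    have "\<exists>q. next_node thread_ok p q \<and> (?on p \<longrightarrow> (\<exists>h\<in>D. q = ?\<rho> h))"
    proof (cases "?on p")
      case True
      then obtain g where g: "g \<in> Field r" "p = ?\<rho> g" "g \<in> D \<or> underS r g = {}" by blast
      show ?thesis by (rule cut_next_node[OF c D g(1,3)]) (use g(2) in blast)
    next
      case False
      then show ?thesis using next_node_exists[OF p] by blast
    qed
    then show ?thesis unfolding S_def by (rule someI_ex)
  qed
  have L: "legal thread_ok S" unfolding legal_def using S_prop by blast
  \<comment> \<open>The run never leaves \<open>(c, D)\<close>: the join of cuts at points of
    \<open>D\<close> is the cut at their supremum, which is one of these points, a limit point of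
    \<open>D\<close>, or 0.\<close>
  have on: "?on (run S x)" if x: "x \<in> Field r" for x
    using x
  proof (induction rule: lt_induct)
    case (less x)
    have "\<exists>h\<in>D. S y (run S y) = ?\<rho> h" if y: "y \<sqsubset> x" for y
      using S_prop[OF run_node[OF L lt_Field(1)[OF y]]] less.IH[OF y] by blast
    then obtain h where h: "\<And>y. y \<sqsubset> x \<Longrightarrow> h y \<in> D" "\<And>y. y \<sqsubset> x \<Longrightarrow> S y (run S y) = ?\<rho> (h y)"
      by metis
    define G where "G = h ` underS r x"
    have "(\<lambda>y. S y (run S y)) ` underS r x = ?\<rho> ` G"
      unfolding G_def image_image using h(2) by (rule image_cong[OF refl])
    then have run: "run S x = join (?\<rho> ` G)" unfolding run_eq[of S x] by (rule arg_cong)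
    have levG: "lev ` ?\<rho> ` G = G" by force
    let ?u = "lev (run S x)"
    have u: "?u \<in> Field r" by (rule node_Field[OF run_node[OF L less.hyps]])
    have bd: "\<forall>g\<in>G. g \<sqsubseteq> ?u"
    proof
      fix g assume "g \<in> G"
      then obtain y where y: "y \<sqsubset> x" "g = h y" unfolding G_def by blast
      then have "ext (?\<rho> g) (run S x)" using run_node_ext[OF L less.hyps] h(2) by metis
      then show "g \<sqsubseteq> ?u" unfolding ext_def by simp
    qed
    have GD: "G \<subseteq> D" using h(1) unfolding G_def by blast
    have under: "underS r (lub G) = (\<Union>g\<in>G. underS r g)" by (rule underS_lub[OF u bd])
    have lF: "lub G \<in> Field r" by (rule lub_Field[OF u bd])
    have "(\<Union>p\<in>?\<rho> ` G. sq p a) = cut (lub G) c a" for a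
      using under unfolding cut_def by auto
    then have "join (?\<rho> ` G) = ?\<rho> (lub G)"
      unfolding join_def levG using under by auto
    moreover have "lub G \<in> D" if ne: "underS r (lub G) \<noteq> {}"
    proof (cases "lub G \<in> G")
      case True
      then show ?thesis using GD by blast
    next
      case False
      have "is_limit_point r D (lub G)"
        unfolding limit_point_iff
      proof (intro conjI allI impI ne)
        fix d assume "d \<sqsubset> lub G"
        then obtain g where g: "g \<in> G" "d \<sqsubset> g" using under by blast
        then have "g \<sqsubset> lub G" using lub_upper[OF u bd g(1)] False lt_iff by blast
        then show "\<exists>c\<in>D. d \<sqsubset> c \<and> c \<sqsubset> lub G" using g GD by blast
      qed
      then show ?thesis by (rule thread_club(3)[OF D])
    qed
    ultimately show ?case using run lF by auto
  qed
  define x where "x = (\<lambda>y\<in>Field r. inv_into (Field r) (code (run S y)) (S y (run S y)))"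
  have img: "S y (run S y) \<in> code (run S y) ` Field r" if "y \<in> Field r" for y
    using code_bij[OF run_node[OF L that]] run_next[OF L that] unfolding bij_betw_def by blast
  have x: "x \<in> Field r \<rightarrow>\<^sub>E Field r"
    using inv_into_into[OF img] unfolding x_def by auto
  then have Lx: "legal thread_ok (walk x)" using walk_legal by blast
  have step: "walk x y (run S y) = S y (run S y)" if "y \<in> Field r" for y
    unfolding walk_def x_def using f_inv_into_f[OF img[OF that]] that by simp
  have run: "run S y = run (walk x) y" if y: "y \<in> Field r" for y
    by (rule run_cong[OF y]) (use step lt_Field(1) in auto)
  have "seq_of (walk x) a = c a" for a
  proof (cases "a \<in> Field r")
    case True
    then obtain b where b: "a \<sqsubset> b" "b \<in> Field r" by (rule greater_exists)
    have a: "a \<sqsubset> lev (run S b)" using b run_level[OF L b(2)] lt_le_trans by blast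
    then have "seq_of (walk x) a = sq (run S b) a" using seq_of_run[OF Lx b(2)] run[OF b(2)] by simp
    moreover obtain g where "run S b = ?\<rho> g" using on[OF b(2)] by blast
    ultimately show ?thesis using a by (simp add: cut_def)
  next
    case False
    then show ?thesis using c seq_of_Coh[OF Lx] unfolding Coh_iff by simp
  qed
  then show ?thesis using x by blast
qed

lemma Triv_image: "(\<lambda>x. seq_of (walk x)) ` (Field r \<rightarrow>\<^sub>E Field r) = Triv r n"
proof
  show "Triv r n \<subseteq> (\<lambda>x. seq_of (walk x)) ` (Field r \<rightarrow>\<^sub>E Field r)" using surj_walk by blast
  have "seq_of (walk x) \<in> Triv r n" if "x \<in> Field r \<rightarrow>\<^sub>E Field r" for x
  proof -
    have "legal thread_ok (walk x)" using walk_legal that by blast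
    then show ?thesis unfolding Triv_iff using seq_of_Coh thread_path_of by blast
  qed
  then show "(\<lambda>x. seq_of (walk x)) ` (Field r \<rightarrow>\<^sub>E Field r) \<subseteq> Triv r n" by blast
qed

subsection \<open>Failure of the Baire property\<close>

text \<open>First follow \<open>C\<close> strictly past \<open>lev p\<close>, which fixes the value
  that \<open>Q\<close> demands there, and past \<open>g\<close>; only then deviate from
  \<open>C\<close> to avoid \<open>N\<close>.\<close>

lemma avoiding_next_node:
  assumes p: "node Q p" and C: "C \<in> Coh r n" "\<forall>a. a \<sqsubset> lev p \<longrightarrow> C a = sq p a"
    and Q: "is_limit_point r (pt p) (lev p) \<longrightarrow> Q (lev p) (pt p) (C (lev p))"
    and N: "nowhere_dense (Coh_top r n) N" and g: "g \<in> Field r"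
  shows "\<exists>q. next_node Q p q \<and> (\<forall>C'\<in>Coh r n. (\<forall>a. a \<sqsubset> lev q \<longrightarrow> C' a = sq q a) \<longrightarrow> C' \<notin> N) \<and>
    (\<forall>a. a \<sqsubset> g \<longrightarrow> a \<sqsubset> lev q \<and> sq q a = C a)"
proof -
  obtain h where h: "h \<in> Field r" "lev p \<sqsubset> h" "g \<sqsubset> h" by (rule greater2_exists[OF node_Field[OF p] g])
  obtain C' k where C': "C' \<in> Coh r n" "\<forall>a. a \<sqsubset> h \<longrightarrow> C' a = C a" and k: "h \<sqsubset> k"
    "\<forall>C''\<in>Coh r n. (\<forall>a. a \<sqsubset> k \<longrightarrow> C'' a = C' a) \<longrightarrow> C'' \<notin> N"
    by (rule nowhere_dense_avoid[OF N C(1) h(1)])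
  let ?q = "(k, cut k C', insert (lev p) (pt p))"
  have "\<forall>a. a \<sqsubset> lev p \<longrightarrow> C' a = sq p a" using C(2) C'(2) lt_trans[OF _ h(2)] by metis
  moreover have "is_limit_point r (pt p) (lev p) \<longrightarrow> Q (lev p) (pt p) (C' (lev p))" using Q C'(2) h(2) by metis
  ultimately have "next_node Q p ?q"
    using next_node_extension[OF p C'(1)] lt_trans[OF h(2) k(1)] by blast
  moreover have "\<forall>C''\<in>Coh r n. (\<forall>a. a \<sqsubset> lev ?q \<longrightarrow> C'' a = sq ?q a) \<longrightarrow> C'' \<notin> N"
    using k(2) by (simp add: cut_def)
  moreover have "\<forall>a. a \<sqsubset> g \<longrightarrow> a \<sqsubset> lev ?q \<and> sq ?q a = C a"
    using C'(2) lt_trans[OF _ h(3)] lt_trans[OF _ k(1)] by (simp add: cut_def)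
  ultimately show ?thesis by blast
qed

text \<open>The nowhere dense sets are indexed by stages, and the move at stage \<open>x\<close>
  commits to an initial segment that excludes \<open>N x\<close>.\<close>

lemma avoiding_run:
  assumes adm: "\<And>p. node Q p \<Longrightarrow> \<exists>C\<in>Coh r n. (\<forall>a. a \<sqsubset> lev p \<longrightarrow> C a = sq p a) \<and>
      (is_limit_point r (pt p) (lev p) \<longrightarrow> Q (lev p) (pt p) (C (lev p)))"
    and N: "\<forall>x\<in>Field r. nowhere_dense (Coh_top r n) (N x)"
    and C: "C \<in> Coh r n" and g: "g \<in> Field r"
  obtains S where "legal Q S" "\<forall>x\<in>Field r. seq_of S \<notin> N x" "\<forall>a. a \<sqsubset> g \<longrightarrow> seq_of S a = C a"
proof -
  \<comment> \<open>The last clause concerns the move from level 0, where the run begins: it copies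
    \<open>C\<close> up to \<open>g\<close>.\<close>
  let ?P = "\<lambda>x p q. next_node Q p q \<and>
    (\<forall>C'\<in>Coh r n. (\<forall>a. a \<sqsubset> lev q \<longrightarrow> C' a = sq q a) \<longrightarrow> C' \<notin> N x) \<and>
    (underS r (lev p) = {} \<longrightarrow> (\<forall>a. a \<sqsubset> g \<longrightarrow> a \<sqsubset> lev q \<and> sq q a = C a))"
  define S where "S x p = (SOME q. ?P x p q)" for x p
  have S: "?P x p (S x p)" if p: "node Q p" and x: "x \<in> Field r" for x p
  proof -
    have Nx: "nowhere_dense (Coh_top r n) (N x)" using N x by blast
    have "\<exists>q. ?P x p q"
    proof (cases "underS r (lev p) = {}")
      case True
      \<comment> \<open>At level 0 nothing has been fixed and there is no limit point, so the given
        \<open>C\<close> can be followed.\<close>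
      then have "\<forall>a. a \<sqsubset> lev p \<longrightarrow> C a = sq p a" "\<not> is_limit_point r (pt p) (lev p)"
        by (auto simp: limit_point_iff)
      then show ?thesis using avoiding_next_node[OF p C _ _ Nx g] by blast
    next
      case False
      then show ?thesis using adm[OF p] avoiding_next_node[OF p _ _ _ Nx g] by metis
    qed
    then show ?thesis unfolding S_def by (rule someI_ex)
  qed
  have L: "legal Q S" unfolding legal_def using S by blast
  have "seq_of S \<notin> N x" if x: "x \<in> Field r" for x
    using S[OF run_node[OF L x] x] seq_of_Coh[OF L] seq_of_step[OF L x] by blast
  moreover obtain z where z: "z \<in> Field r" "underS r z = {}" by (rule least_elem)
  have "underS r (lev (run S z)) = {}"
    unfolding run_eq[of S z] join_def fst_conv z(2) using underS_lub[OF z(1), of "{}"] by simp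
  then have "\<forall>a. a \<sqsubset> g \<longrightarrow> seq_of S a = C a"
    using S[OF run_node[OF L z(1)] z(1)] seq_of_step[OF L z(1)] by metis
  ultimately show ?thesis using that L by blast
qed

lemma not_Baire: "\<not> kappa_Baire (Coh_top r n) r (Triv r n)"
proof
  assume "kappa_Baire (Coh_top r n) r (Triv r n)"
  then obtain U N where U: "openin (Coh_top r n) U"
    and N: "\<forall>a\<in>Field r. nowhere_dense (Coh_top r n) (N a)"
    and sub: "(Triv r n - U) \<union> (U - Triv r n) \<subseteq> (\<Union>a\<in>Field r. N a)"
    unfolding kappa_Baire_def by blast
  show False
  proof (cases "U = {}")
    case True
    \<comment> \<open>The sequence of ladders serves as some element of \<open>Coh r n\<close> to
      start from.\<close>
    have C: "(\<lambda>a. if a \<in> {} then {} else if a \<in> Field r then ladder a else {}) \<in> Coh r n"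
      by (rule ladder_extension) auto
    obtain z where z: "z \<in> Field r" by (rule least_elem)
    obtain S where S: "legal thread_ok S" "\<forall>x\<in>Field r. seq_of S \<notin> N x"
      by (rule avoiding_run[OF thread_extension N C z])
    then have "seq_of S \<in> Triv r n" unfolding Triv_iff using seq_of_Coh thread_path_of by blast
    then show False using S(2) sub True by blast
  next
    case False
    then obtain C where C: "C \<in> U" by blast
    then have CC: "C \<in> Coh r n" using openin_subset[OF U] topspace_Coh by blast
    obtain g where g: "g \<in> Field r" "\<forall>C'\<in>Coh r n. (\<forall>a. a \<sqsubset> g \<longrightarrow> C' a = C a) \<longrightarrow> C' \<in> U"
      using open_contains_ball[OF U C] by blast
    obtain S where S: "legal thin_ok S" "\<forall>x\<in>Field r. seq_of S \<notin> N x" "\<forall>a. a \<sqsubset> g \<longrightarrow> seq_of S a = C a"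
      by (rule avoiding_run[OF thin_extension N CC g(1)])
    then have "seq_of S \<in> U" using g(2) seq_of_Coh by blast
    then show False using S(2) sub thin_seq_of_not_Triv[OF S(1)] by blast
  qed
qed

end

theorem theorem3p4:
  fixes n :: "'b rel" and r :: "'a rel"
  assumes "Card_order n" and "\<not> finite (Field n)" and "regularCard n"
    and "Well_order r" and "(r, cardSuc n) \<in> ordIso" and "(card_of (Pow (Field n)), r) \<in> ordIso"
  shows "(\<exists>f. continuous_map (Baire_space r) (Coh_top r n) f
              \<and> inj_on f (topspace (Baire_space r))
              \<and> f ` topspace (Baire_space r) = Triv r n)
         \<and> \<not> kappa_Baire (Coh_top r n) r (Triv r n)"
proof -
  interpret nu_kappa n r using assms by unfold_locales
  show ?thesis
    using continuous_walk inj_walk Triv_image not_Baire unfolding topspace_Baire by blast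
qed

end
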